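(* Let $U$ have the Whitney property. Then for any $(u,v)\in\overline{BV}_{loc}(T)\times L^1(T)$ with $u(0)=\bar u_0$ there exists a $BV_{loc}$ graph completion of $(u,v)$ of the form $(\varphi_0,\varphi,\psi,+\infty)$ (i.e. with $S=+\infty$), and for any clock $\sigma$ (provided that the corresponding space-time solution $\xi=\xi[\bar x_0,\bar u_0,\varphi_0,\varphi,\psi]$ is bounded) there is an associated $BV_{loc}$ graph completion solution $x$ on $[0,T]$ of $\dot x=g_0(x,u,v)+\sum_{i=1}^m g_i(x,u)\dot u_i$, $x(0)=\bar x_0$, $u(0)=\bar u_0$.
   Context: Standing setting. $T>0$; $U\subset\mathbb R^m$ and $V\subset\mathbb R^l$ are compact; $(\bar x_0,\bar u_0)\in\mathbb R^n\times U$. The map $g_0:\mathbb R^n\times U\times V\to\mathbb R^n$ is continuous and $(x,u)\mapsto g_0(x,u,v)$ is locally Lipschitz on $\mathbb R^n\times U$ uniformly in $v\in V$; for $i=1,\dots,m$, $g_i:\mathbb R^n\times U\to\mathbb R^n$ is locally Lipschitz; there is $M>0$ with $|(g_0(x,u,v),g_1(x,u),\dots,g_m(x,u))|\le M(1+|(x,u)|)$ for all $(x,u,v)$. $L^1(T)$ is the set of (classes of) Lebesgue integrable maps $v:[0,T]\to V$, with Borel measurable representatives used when pointwise values are needed; $\overline{BV}_{loc}(T)$ is the set of maps $u:[0,T]\to U$ which have bounded variation on $[0,t]$ for every $t<T$ (the variation on $[0,T]$ may be infinite). Whitney property: there is $C\ge1$ such that for all $u_1,u_2\in U$ there is an absolutely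 continuous $\tilde u:[0,1]\to U$ with $\tilde u(0)=u_1$, $\tilde u(1)=u_2$ and total variation $\le C|u_1-u_2|$. Feasible space-time controls: $\Gamma(T;\bar u_0)$ is the set of $(\varphi_0,\varphi,\psi,S)$ with $0<S\le+\infty$, $(\varphi_0,\varphi):[0,S[\to[0,+\infty[\times U$ $1$-Lipschitz, $\psi:[0,S[\to V$ measurable, $\varphi_0(0)=0$, $\varphi(0)=\bar u_0$, $\varphi_0'\ge0$ and $\varphi_0'+|\varphi'|=1$ a.e., $\lim_{s\to S}\varphi_0(s)=T$. The corresponding $\xi=\xi[\bar x_0,\bar u_0,\varphi_0,\varphi,\psi]$ is the solution on $[0,S[$ of $$\xi'(s)=g_0(\xi,\varphi,\psi)\varphi_0'(s)+\sum_{i=1}^m g_i(\xi,\varphi)\varphi_i'(s),\qquad \xi(0)=\bar x_0.$$ If $S<+\infty$, $(\xi,\varphi_0,\varphi)$ is extended to $[0,S]$ by continuity. If $S=+\infty$ and $\xi$ is bounded, put $(\xi,\varphi)_{set}(+\infty):=\{\lim_j(\xi,\varphi)(s_j):\ \text{for some } s_j\nearrow+\infty\}$. $BV_{loc}$ graph completion: $(\varphi_0,\varphi,\psi,S)\in\Gamma(T;\bar u_0)$ is a $BV_{loc}$ graph completion of $(u,v)\in\overline{BV}_{loc}(T)\times L^1(T)$, $u(0)=\bar u_0$, if (1) for every $t\in[0,T[$ there is $s\in[0,S[$ with $(\varphi_0,\varphi,\psi)(s)=(t,u(t),v(t))$; (2) if $S<+\infty$, $(\varphi_0,\varphi)(S)=(T,u(T))$;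 (3) if $S=+\infty$, $\lim_j\varphi(s_j)=u(T)$ for some $s_j\nearrow+\infty$ (abbreviated $(\varphi_0,\varphi)(+\infty)=(T,u(T))$). A clock is an increasing function $\sigma:[0,T]\to[0,S]$ with $(\varphi_0,\varphi)(\sigma(t))=(t,u(t))$ for every $t\in[0,T]$, $\sigma(0)=0$, $\sigma(T)=S$ (when $S=+\infty$ the condition at $t=T$ just means (3), and $\lim_{t\to T^-}\sigma(t)<+\infty$ is allowed). $BV_{loc}$ graph completion solution: given a $BV_{loc}$ graph completion of $(u,v)$ and a clock $\sigma$, with $\xi$ bounded when $S=+\infty$, it is a map $x:[0,T]\to\mathbb R^n$ with $x(t)=\xi(\sigma(t))$ for $t\in[0,T[$, and $x(T)=\xi(S)$ if $S<+\infty$, $(x(T),u(T))\in(\xi,\varphi)_{set}(+\infty)$ if $S=+\infty$.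
   Formalization: It is additionally assumed that U is not the single point ū_0; for U={ū_0} the control φ is constant, so φ_0(s)=s and S=T<+∞, and no graph completion with S=+∞ exists. *)

theory Defs
  imports "HOL-Analysis.Analysis"
begin

definition total_variation :: "(real \<Rightarrow> 'a::metric_space) \<Rightarrow> real \<Rightarrow> real \<Rightarrow> ereal" where
  "total_variation f a b =
     (SUP (k, p) \<in> {(k :: nat, p :: nat \<Rightarrow> real).
          (\<forall>i\<le>k. p i \<in> {a..b}) \<and> (\<forall>i<k. p i \<le> p (Suc i))}.
        ereal (\<Sum>i<k. dist (f (p i)) (f (p (Suc i)))))"

definition abs_continuous_on :: "real \<Rightarrow> real \<Rightarrow> (real \<Rightarrow> 'a::metric_space) \<Rightarrow> bool" where
  "abs_continuous_on a b f \<longleftrightarrow>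
     (\<forall>\<epsilon>>0. \<exists>\<delta>>0. \<forall>(k :: nat) (p :: nat \<Rightarrow> real) (q :: nat \<Rightarrow> real).
        (\<forall>i<k. a \<le> p i \<and> p i \<le> q i \<and> q i \<le> b) \<and>
        disjoint_family_on (\<lambda>i. {p i<..<q i}) {..<k} \<and>
        (\<Sum>i<k. q i - p i) < \<delta> \<longrightarrow>
        (\<Sum>i<k. dist (f (p i)) (f (q i))) < \<epsilon>)"

definition locally_lipschitz_on :: "'a::metric_space set \<Rightarrow> ('a \<Rightarrow> 'b::metric_space) \<Rightarrow> bool" where
  "locally_lipschitz_on D f \<longleftrightarrow>
     (\<forall>p\<in>D. \<exists>r>0. \<exists>L. L-lipschitz_on (cball p r \<inter> D) f)"

definition locally_lipschitz_on_unif ::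
    "'a::metric_space set \<Rightarrow> 'w set \<Rightarrow> ('w \<Rightarrow> 'a \<Rightarrow> 'b::metric_space) \<Rightarrow> bool" where
  "locally_lipschitz_on_unif D W f \<longleftrightarrow>
     (\<forall>p\<in>D. \<exists>r>0. \<exists>L. \<forall>w\<in>W. L-lipschitz_on (cball p r \<inter> D) (f w))"

definition whitney_property :: "'a::real_normed_vector set \<Rightarrow> bool" where
  "whitney_property U \<longleftrightarrow>
     (\<exists>C\<ge>1. \<forall>u1\<in>U. \<forall>u2\<in>U. \<exists>w.
        abs_continuous_on 0 1 w \<and> w \<in> {0..1} \<rightarrow> U \<and> w 0 = u1 \<and> w 1 = u2 \<and>
        total_variation w 0 1 \<le> ereal (C * norm (u1 - u2)))"

text \<open>The variation of \<open>u\<close> on the whole of \<open>[0,T]\<close> is allowed to be infinite.\<close>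

definition BV_loc :: "real \<Rightarrow> 'a::metric_space set \<Rightarrow> (real \<Rightarrow> 'a) set" where
  "BV_loc T U = {u. u \<in> {0..T} \<rightarrow> U \<and> (\<forall>t. 0 \<le> t \<and> t < T \<longrightarrow> total_variation u 0 t < \<infinity>)}"

text \<open>Pointwise values of \<open>v\<close> matter below, so an element of \<open>L\<^sup>1\<close> is given by a
  representative; integrability with respect to \<^const>\<open>lborel\<close> makes it Borel
  measurable on \<open>[0,T]\<close>.\<close>

definition L1 :: "real \<Rightarrow> 'a::euclidean_space set \<Rightarrow> (real \<Rightarrow> 'a) set" where
  "L1 T V = {v. v \<in> {0..T} \<rightarrow> V \<and> set_integrable lborel {0..T} v}"

text \<open>The half-open interval \<open>[0,S[\<close>, where \<open>S\<close> may be \<open>\<infinity>\<close>, and the filter of \<open>s\<close> tending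
  to \<open>S\<close> from the left.\<close>

definition Ico0 :: "ereal \<Rightarrow> real set" where
  "Ico0 S = {s. 0 \<le> s \<and> ereal s < S}"

definition towards :: "ereal \<Rightarrow> real filter" where
  "towards S = (if S = \<infinity> then at_top else at_left (real_of_ereal S))"

text \<open>The set of limits \<open>lim f(s\<^sub>j)\<close> along sequences increasing to infinity; this is
  \<open>f\<^sub>s\<^sub>e\<^sub>t(+\<infinity>)\<close>.\<close>

definition limit_set :: "(real \<Rightarrow> 'a::topological_space) \<Rightarrow> 'a set" where
  "limit_set f = {l. \<exists>s :: nat \<Rightarrow> real.
     (\<forall>j. 0 \<le> s j) \<and> incseq s \<and> filterlim s at_top sequentially \<and>
     (\<lambda>j. f (s j)) \<longlonglongrightarrow> l}"

definition space_time_controls ::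
    "'a::euclidean_space set \<Rightarrow> 'b::euclidean_space set \<Rightarrow> real \<Rightarrow> 'a \<Rightarrow>
     ((real \<Rightarrow> real) \<times> (real \<Rightarrow> 'a) \<times> (real \<Rightarrow> 'b) \<times> ereal) set" where
  "space_time_controls U V T u0 = {(\<phi>0, \<phi>, \<psi>, S).
     0 < S \<and>
     \<phi>0 \<in> Ico0 S \<rightarrow> {0..} \<and> \<phi> \<in> Ico0 S \<rightarrow> U \<and>
     1-lipschitz_on (Ico0 S) (\<lambda>s. (\<phi>0 s, \<phi> s)) \<and>
     \<psi> \<in> Ico0 S \<rightarrow> V \<and> \<psi> \<in> borel_measurable (lebesgue_on (Ico0 S)) \<and>
     \<phi>0 0 = 0 \<and> \<phi> 0 = u0 \<and>
     (AE s in lebesgue_on (Ico0 S).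
        \<phi>0 differentiable (at s) \<and> \<phi> differentiable (at s) \<and>
        deriv \<phi>0 s \<ge> 0 \<and> deriv \<phi>0 s + norm (vector_derivative \<phi> (at s)) = 1) \<and>
     (\<phi>0 \<longlongrightarrow> T) (towards S)}"

text \<open>Caratheodory solution on \<open>[0,S[\<close> of the space-time system.  It is unique on \<open>[0,S[\<close>
  under the usual Lipschitz and growth assumptions on \<open>g0\<close> and \<open>g\<close>.\<close>

definition space_time_solution ::
    "(real^'n \<Rightarrow> real^'m \<Rightarrow> real^'l \<Rightarrow> real^'n) \<Rightarrow> ('m \<Rightarrow> real^'n \<Rightarrow> real^'m \<Rightarrow> real^'n) \<Rightarrow>
     real^'n \<Rightarrow> (real \<Rightarrow> real) \<Rightarrow> (real \<Rightarrow> real^'m) \<Rightarrow> (real \<Rightarrow> real^'l) \<Rightarrow> ereal \<Rightarrow>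
     (real \<Rightarrow> real^'n) \<Rightarrow> bool" where
  "space_time_solution g0 g x0 \<phi>0 \<phi> \<psi> S \<xi> \<longleftrightarrow>
     (\<forall>r\<in>Ico0 S. abs_continuous_on 0 r \<xi>) \<and>
     (AE s in lebesgue_on (Ico0 S).
        (\<xi> has_vector_derivative
           deriv \<phi>0 s *\<^sub>R g0 (\<xi> s) (\<phi> s) (\<psi> s) +
           (\<Sum>i\<in>UNIV. (vector_derivative \<phi> (at s) $ i) *\<^sub>R g i (\<xi> s) (\<phi> s))) (at s)) \<and>
     \<xi> 0 = x0"

text \<open>\<open>curve_value \<phi>0 \<phi> S s t w\<close> means \<open>(\<phi>0,\<phi>)(s) = (t,w)\<close> for \<open>s \<in> [0,S]\<close>.  At \<open>s = S < \<infinity>\<close>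
  the curve is extended by continuity; at \<open>s = S = \<infinity>\<close> the equation is a convention: \<open>\<phi>0\<close>
  tends to \<open>t\<close> and \<open>w\<close> is one of the possibly many limit points of \<open>\<phi>\<close>.\<close>

definition curve_value ::
    "(real \<Rightarrow> real) \<Rightarrow> (real \<Rightarrow> 'a::metric_space) \<Rightarrow> ereal \<Rightarrow> ereal \<Rightarrow> real \<Rightarrow> 'a \<Rightarrow> bool" where
  "curve_value \<phi>0 \<phi> S s t w \<longleftrightarrow>
     (if s < S then \<phi>0 (real_of_ereal s) = t \<and> \<phi> (real_of_ereal s) = w
      else (\<phi>0 \<longlongrightarrow> t) (towards S) \<and>
           (if S < \<infinity> then (\<phi> \<longlongrightarrow> w) (towards S) else w \<in> limit_set \<phi>))"

definition BV_loc_graph_completion ::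
    "'a::euclidean_space set \<Rightarrow> 'b::euclidean_space set \<Rightarrow> real \<Rightarrow> 'a \<Rightarrow>
     (real \<Rightarrow> 'a) \<Rightarrow> (real \<Rightarrow> 'b) \<Rightarrow>
     (real \<Rightarrow> real) \<Rightarrow> (real \<Rightarrow> 'a) \<Rightarrow> (real \<Rightarrow> 'b) \<Rightarrow> ereal \<Rightarrow> bool" where
  "BV_loc_graph_completion U V T u0 u v \<phi>0 \<phi> \<psi> S \<longleftrightarrow>
     (\<phi>0, \<phi>, \<psi>, S) \<in> space_time_controls U V T u0 \<and>
     (\<forall>t\<in>{0..<T}. \<exists>s\<in>Ico0 S. \<phi>0 s = t \<and> \<phi> s = u t \<and> \<psi> s = v t) \<and>
     curve_value \<phi>0 \<phi> S S T (u T)"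

text \<open>Since \<open>\<phi>0\<close> has the value \<open>t\<close> at \<open>\<sigma> t\<close>, a clock is automatically strictly increasing,
  and \<open>\<sigma> t < S\<close> for \<open>t < T\<close>.\<close>

definition clock ::
    "real \<Rightarrow> (real \<Rightarrow> 'a::metric_space) \<Rightarrow> (real \<Rightarrow> real) \<Rightarrow> (real \<Rightarrow> 'a) \<Rightarrow> ereal \<Rightarrow>
     (real \<Rightarrow> ereal) \<Rightarrow> bool" where
  "clock T u \<phi>0 \<phi> S \<sigma> \<longleftrightarrow>
     \<sigma> \<in> {0..T} \<rightarrow> {0..S} \<and> mono_on {0..T} \<sigma> \<and>
     (\<forall>t\<in>{0..T}. curve_value \<phi>0 \<phi> S (\<sigma> t) t (u t)) \<and>
     \<sigma> 0 = 0 \<and> \<sigma> T = S"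

definition BV_loc_graph_completion_solution ::
    "(real^'n \<Rightarrow> real^'m \<Rightarrow> real^'l \<Rightarrow> real^'n) \<Rightarrow> ('m \<Rightarrow> real^'n \<Rightarrow> real^'m \<Rightarrow> real^'n) \<Rightarrow>
     (real^'m) set \<Rightarrow> (real^'l) set \<Rightarrow> real \<Rightarrow> real^'n \<Rightarrow> real^'m \<Rightarrow>
     (real \<Rightarrow> real^'m) \<Rightarrow> (real \<Rightarrow> real^'l) \<Rightarrow>
     (real \<Rightarrow> real) \<Rightarrow> (real \<Rightarrow> real^'m) \<Rightarrow> (real \<Rightarrow> real^'l) \<Rightarrow> ereal \<Rightarrow>
     (real \<Rightarrow> ereal) \<Rightarrow> (real \<Rightarrow> real^'n) \<Rightarrow> (real \<Rightarrow> real^'n) \<Rightarrow> bool" where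
  "BV_loc_graph_completion_solution g0 g U V T x0 u0 u v \<phi>0 \<phi> \<psi> S \<sigma> \<xi> x \<longleftrightarrow>
     BV_loc_graph_completion U V T u0 u v \<phi>0 \<phi> \<psi> S \<and>
     clock T u \<phi>0 \<phi> S \<sigma> \<and>
     space_time_solution g0 g x0 \<phi>0 \<phi> \<psi> S \<xi> \<and>
     (S = \<infinity> \<longrightarrow> bounded (\<xi> ` Ico0 S)) \<and>
     (\<forall>t\<in>{0..<T}. x t = \<xi> (real_of_ereal (\<sigma> t))) \<and>
     (if S < \<infinity> then (\<xi> \<longlongrightarrow> x T) (towards S)
      else (x T, u T) \<in> limit_set (\<lambda>s. (\<xi> s, \<phi> s)))"

end

theory Submission
  imports Defs
begin

text \<open>
  Fix \<open>\<tau>\<^sub>j\<close> increasing to \<open>T\<close> and a point \<open>w \<in> U\<close> other than \<open>u T\<close>.  The graph of \<open>u\<close>, parametrized by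
  \<open>t\<close> plus a multiple of the variation of \<open>u\<close> on \<open>[0,t]\<close>, is a Lipschitz curve with gaps at the jumps
  of \<open>u\<close>.  At each \<open>\<tau>\<^sub>j\<close> a further gap is opened for a loop through \<open>u T\<close> and \<open>w\<close>.  Time stands still
  across every gap, so Whitney paths fill them.  Each loop has length at least \<open>|w - u T|\<close>, hence
  the curve has infinite length and visits \<open>u T\<close> at arbitrarily large arc lengths.  In the arc-length
  parametrization \<open>\<phi>\<^sub>0' + |\<phi>'| = 1\<close> holds almost everywhere: \<open>\<le>\<close> is the Lipschitz bound, and equality
  follows from \<open>Var(\<phi>) \<le> \<integral>|\<phi>'|\<close>, which rests on Lebesgue's theorem for Lipschitz functions.  The
  component \<open>\<psi>\<close> is \<open>v \<circ> \<phi>\<^sub>0\<close>.  The terminal value of the solution is the limit of \<open>\<xi>\<close> along a subsequence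
  on which \<open>\<phi>\<close> tends to \<open>u T\<close>.
\<close>

section \<open>Differentiability of Lipschitz functions\<close>

text \<open>Adding \<open>(L + 1) * x\<close> turns \<open>f\<close> into an increasing bijection
  \<open>F\<close> of the line with slopes between 1 and \<open>2 * L + 1\<close>. Radon-Nikodym
  yields a density for the measure attached to \<open>F\<close>, and subtracting
  \<open>L + 1\<close> from it returns to \<open>f\<close>.\<close>

lemma lipschitz_real_density:
  fixes f :: "real \<Rightarrow> real"
  assumes "L-lipschitz_on UNIV f"
  obtains g where "\<And>a b. a \<le> b \<Longrightarrow> (g has_integral (f b - f a)) {a..b}"
proof -
  have L: "\<bar>f y - f x\<bar> \<le> L * \<bar>y - x\<bar>" "0 \<le> L" for x y
    using lipschitz_onD[OF assms, of y x] lipschitz_on_nonneg[OF assms] by (auto simp: dist_real_def)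
  define F where "F x = f x + (L + 1) * x" for x
  have F_le: "y - x \<le> F y - F x" if "x \<le> y" for x y
    using L(1)[of y x] that by (auto simp: F_def algebra_simps)
  have F_lip: "(2 * L + 1)-lipschitz_on UNIV F"
  proof (rule lipschitz_onI)
    fix x y :: real
    have "\<bar>F x - F y\<bar> \<le> \<bar>f x - f y\<bar> + (L + 1) * \<bar>x - y\<bar>"
      unfolding F_def using L(2) abs_mult[of "L+1" "x-y"] by (simp add: algebra_simps)
    also have "\<dots> \<le> (2 * L + 1) * \<bar>x - y\<bar>"
      using L(1)[of x y] by (simp add: algebra_simps)
    finally show "dist (F x) (F y) \<le> (2 * L + 1) * dist x y"
      by (simp add: dist_real_def)
  qed (use L(2) in simp)
  have F_cont: "continuous_on A F" for A
    using lipschitz_on_continuous_on[OF lipschitz_on_subset[OF F_lip]] by blast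
  have F_iff: "F x \<le> F y \<longleftrightarrow> x \<le> y" for x y
    using F_le[of x y] F_le[of y x] by linarith
  have F_surj: "\<exists>x. F x = y" for y
  proof -
    define K where "K = \<bar>y - F 0\<bar>"
    have "F (- K) \<le> y" "y \<le> F K"
      using F_le[of "-K" 0] F_le[of 0 K] unfolding K_def by linarith+
    then show ?thesis
      using IVT'[of F "-K" y K] F_cont K_def by auto
  qed
  then obtain G where FG: "\<And>y. F (G y) = y" by metis
  have GF: "G (F x) = x" for x
    by (metis F_iff FG order_antisym order_refl)
  have "mono G" by (rule monoI) (metis F_iff FG)
  then have G_meas [measurable]: "G \<in> borel_measurable borel"
    by (rule borel_measurable_mono)
  \<comment> \<open>\<open>N\<close> is the measure with distribution function \<open>F\<close>; it is absolutely continuous because the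
    Lipschitz map \<open>F\<close> preserves null sets, and the density of \<open>N\<close> is the derivative sought.\<close>
  define N where "N = distr lborel borel G"
  have vim: "G -` A = F ` A" for A
    using FG GF by (auto simp: image_iff) metis
  have ac: "absolutely_continuous lborel N"
    unfolding absolutely_continuous_def
  proof
    fix A assume A: "A \<in> null_sets (lborel :: real measure)"
    then have "negligible A"
      by (simp add: negligible_iff_null_sets null_sets_completionI)
    then have "negligible (F ` A)"
      by (rule negligible_locally_Lipschitz_image[OF order_refl])
        (use lipschitz_on_normD[OF F_lip] in auto)
    moreover have "F ` A \<in> sets borel"
      using measurable_sets[OF G_meas, of A] A by (auto simp: vim[symmetric] null_sets_def)
    ultimately have "emeasure lborel (F ` A) = 0"
      by (auto simp: negligible_iff_null_sets null_sets_def)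
    with A show "A \<in> null_sets N"
      by (auto simp: N_def null_sets_def emeasure_distr vim)
  qed
  obtain h where h [measurable]: "h \<in> borel_measurable borel" and hN: "density lborel h = N"
    using sigma_finite_measure.Radon_Nikodym[OF sigma_finite_lborel ac] by (auto simp: N_def)
  have int_h: "(\<integral>\<^sup>+x. h x * indicator {a..b} x \<partial>lborel) = ennreal (F b - F a)" if "a \<le> b" for a b
  proof -
    have "(\<integral>\<^sup>+x. h x * indicator {a..b} x \<partial>lborel) = emeasure N {a..b}"
      unfolding hN[symmetric] by (simp add: emeasure_density)
    also have "\<dots> = emeasure lborel (G -` {a..b})"
      by (simp add: N_def emeasure_distr)
    also have "G -` {a..b} = {F a..F b}"
      using F_iff[of a "G _"] F_iff[of "G _" b] FG by auto
    finally show ?thesis using that F_iff by simp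
  qed
  \<comment> \<open>\<open>enn2real\<close> sends infinity to 0, so infinite values of
    \<open>h\<close> must first be confined to a null set; the finite integrals over bounded
    intervals do this.\<close>
  have "AE x in lborel. \<forall>n::nat. h x * indicator {- real n..real n} x \<noteq> \<infinity>"
    unfolding AE_all_countable by (intro allI nn_integral_PInf_AE) (auto simp: int_h)
  then have fin: "AE x in lborel. h x \<noteq> \<infinity>"
  proof (eventually_elim)
    case (elim x)
    obtain n :: nat where "\<bar>x\<bar> \<le> n" using real_arch_simple by blast
    then show ?case using elim[rule_format, of n] by (auto simp: indicator_def abs_le_iff)
  qed
  show thesis
  proof (rule that)
    fix a b :: real assume ab: "a \<le> b"
    have "((\<lambda>x. enn2real (h x) * indicator {a..b} x) has_integral (F b - F a)) UNIV"
    proof (rule nn_integral_has_integral)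
      have "(\<integral>\<^sup>+x. ennreal (enn2real (h x) * indicator {a..b} x) \<partial>lborel)
          = (\<integral>\<^sup>+x. h x * indicator {a..b} x \<partial>lborel)"
        by (rule nn_integral_cong_AE, use fin in eventually_elim)
          (auto simp: indicator_def less_top)
      then show "(\<integral>\<^sup>+x. ennreal (enn2real (h x) * indicator {a..b} x) \<partial>lborel) = ennreal (F b - F a)"
        using int_h[OF ab] by simp
    qed (use ab F_iff in auto)
    moreover have "enn2real (h x) * indicator {a..b} x = (if x \<in> {a..b} then enn2real (h x) else 0)" for x
      by auto
    ultimately have "((\<lambda>x. enn2real (h x)) has_integral (F b - F a)) {a..b}"
      by (subst has_integral_restrict_UNIV[symmetric]) (simp only:)
    from has_integral_diff[OF this has_integral_const_real[of "L+1" a b]] ab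
    show "((\<lambda>x. enn2real (h x) - (L + 1)) has_integral (f b - f a)) {a..b}"
      by (simp add: F_def algebra_simps)
  qed
qed

lemma lipschitz_density:
  fixes f :: "real \<Rightarrow> 'a::euclidean_space"
  assumes "L-lipschitz_on UNIV f"
  obtains h where "\<And>a b. a \<le> b \<Longrightarrow> (h has_integral (f b - f a)) {a..b}"
proof -
  have "\<exists>g. \<forall>a b. a \<le> b \<longrightarrow> (g has_integral (f b \<bullet> i - f a \<bullet> i)) {a..b}" if "i \<in> Basis" for i
  proof -
    have "L-lipschitz_on UNIV (\<lambda>x. f x \<bullet> i)"
    proof (rule lipschitz_onI)
      fix x y
      have "\<bar>(f x - f y) \<bullet> i\<bar> \<le> norm (f x - f y)" using that by (rule Basis_le_norm)
      also have "\<dots> \<le> L * dist x y" using lipschitz_onD[OF assms, of x y] by (simp add: dist_norm)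
      finally show "dist (f x \<bullet> i) (f y \<bullet> i) \<le> L * dist x y"
        by (simp add: dist_real_def inner_diff_left)
    qed (rule lipschitz_on_nonneg[OF assms])
    then show ?thesis by (metis lipschitz_real_density)
  qed
  then obtain g where g: "\<And>i a b. i \<in> Basis \<Longrightarrow> a \<le> b \<Longrightarrow> (g i has_integral (f b \<bullet> i - f a \<bullet> i)) {a..b}"
    by metis
  show thesis
  proof (rule that)
    fix a b :: real assume "a \<le> b"
    then show "((\<lambda>x. \<Sum>i\<in>Basis. g i x *\<^sub>R i) has_integral (f b - f a)) {a..b}"
      by (subst has_integral_componentwise_iff) (auto simp: g inner_diff_left)
  qed
qed

lemma has_vector_derivative_iff_quotient:
  fixes f :: "real \<Rightarrow> 'a::real_normed_vector"
  shows "(f has_vector_derivative D) (at x) \<longleftrightarrow> ((\<lambda>k. (f (x + k) - f x) /\<^sub>R k) \<longlongrightarrow> D) (at 0)"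
proof -
  have "norm ((f (x + k) - f x) /\<^sub>R k - D) = norm (f (x + k) - f x - k *\<^sub>R D) / \<bar>k\<bar>" if "k \<noteq> 0" for k
  proof -
    have "(f (x + k) - f x) /\<^sub>R k - D = (f (x + k) - f x - k *\<^sub>R D) /\<^sub>R k"
      using that by (simp add: scaleR_diff_right)
    then show ?thesis by (simp add: divide_inverse mult.commute)
  qed
  then have "((\<lambda>k. norm ((f (x + k) - f x) /\<^sub>R k - D)) \<longlongrightarrow> 0) (at 0)
      \<longleftrightarrow> ((\<lambda>k. norm (f (x + k) - f x - k *\<^sub>R D) / norm k) \<longlongrightarrow> 0) (at 0)"
    by (intro tendsto_cong) (simp add: eventually_at_filter)
  then show ?thesis
    by (simp add: has_vector_derivative_def has_derivative_at bounded_linear_scaleR_left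
        tendsto_norm_zero_iff LIM_zero_iff)
qed

text \<open>The increments of \<open>f\<close> are integrals of a density, so Lebesgue
  differentiation finds the derivative. The same \<open>h\<close> serves as density and as
  derivative, which later lets the variation be compared with the integral of the speed.\<close>

lemma lipschitz_ae_derivative:
  fixes f :: "real \<Rightarrow> 'a::euclidean_space"
  assumes "L-lipschitz_on UNIV f"
  obtains h N where "negligible N" "\<And>a b. a \<le> b \<Longrightarrow> (h has_integral (f b - f a)) {a..b}"
    "\<And>x. x \<notin> N \<Longrightarrow> (f has_vector_derivative h x) (at x)"
proof -
  obtain h where h: "\<And>a b. a \<le> b \<Longrightarrow> (h has_integral (f b - f a)) {a..b}"
    by (rule lipschitz_density[OF assms]) blast
  have h': "((\<lambda>x. h (- x)) has_integral (f (-a) - f (-b))) {a..b}" if "a \<le> b" for a b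
    using h[of "-b" "-a"] that has_integral_reflect_lemma_real[OF h[of "-b" "-a"]] by simp
  obtain N1 where N1: "negligible N1" "\<And>x e. \<lbrakk>x \<notin> N1; 0 < e\<rbrakk> \<Longrightarrow>
      \<exists>d>0. \<forall>k. 0 < k \<and> k < d \<longrightarrow> norm ((f (x + k) - f x) /\<^sub>R k - h x) < e"
  proof (rule integrable_ccontinuous_explicit[of h])
    show "h integrable_on cbox a b" for a b
      by (cases "a \<le> b") (use h in auto)
    fix N assume N: "negligible N" "\<And>x e. \<lbrakk>x \<notin> N; 0 < e\<rbrakk> \<Longrightarrow> \<exists>d>0. \<forall>k. 0 < k \<and> k < d \<longrightarrow>
        norm (integral (cbox x (x + k *\<^sub>R One)) h /\<^sub>R k ^ DIM(real) - h x) < e"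
    have "integral (cbox x (x + k *\<^sub>R One)) h = f (x + k) - f x" if "0 < k" for x k
      using h[of x "x + k"] that by (simp add: integral_unique)
    with N show thesis using that[of N] by (simp cong: conj_cong imp_cong)
  qed
  obtain N2 where N2: "negligible N2" "\<And>x e. \<lbrakk>x \<notin> N2; 0 < e\<rbrakk> \<Longrightarrow>
      \<exists>d>0. \<forall>k. 0 < k \<and> k < d \<longrightarrow> norm ((f (-x) - f (-x - k)) /\<^sub>R k - h (-x)) < e"
  proof (rule integrable_ccontinuous_explicit[of "\<lambda>x. h (-x)"])
    show "(\<lambda>x. h (-x)) integrable_on cbox a b" for a b
      by (cases "a \<le> b") (use h' in auto)
    fix N assume N: "negligible N" "\<And>x e. \<lbrakk>x \<notin> N; 0 < e\<rbrakk> \<Longrightarrow> \<exists>d>0. \<forall>k. 0 < k \<and> k < d \<longrightarrow>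
        norm (integral (cbox x (x + k *\<^sub>R One)) (\<lambda>x. h (-x)) /\<^sub>R k ^ DIM(real) - h (-x)) < e"
    have "integral (cbox x (x + k *\<^sub>R One)) (\<lambda>x. h (-x)) = f (-x) - f (-x - k)" if "0 < k" for x k
      using h'[of x "x + k"] that by (simp add: integral_unique)
    with N show thesis using that[of N] by (simp cong: conj_cong imp_cong)
  qed
  \<comment> \<open>\<open>integrable_ccontinuous_explicit\<close> only gives right derivatives; \<open>N2\<close> handles the left ones.\<close>
  have "(f has_vector_derivative h x) (at x)" if x: "x \<notin> N1 \<union> uminus ` N2" for x
  proof -
    have "((\<lambda>k. (f (x + k) - f x) /\<^sub>R k) \<longlongrightarrow> h x) (at 0)"
    proof (rule LIM_I)
      fix e :: real assume "0 < e"
      obtain d1 where d1: "d1 > 0" "\<And>k. 0 < k \<Longrightarrow> k < d1 \<Longrightarrow> norm ((f (x + k) - f x) /\<^sub>R k - h x) < e"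
        using N1(2)[of x e] x \<open>0 < e\<close> by auto
      have "-x \<notin> N2" using x by force
      then obtain d2 where d2: "d2 > 0" "\<And>k. 0 < k \<Longrightarrow> k < d2 \<Longrightarrow> norm ((f x - f (x - k)) /\<^sub>R k - h x) < e"
        using N2(2)[of "-x" e] \<open>0 < e\<close> by auto
      have "norm ((f (x + k) - f x) /\<^sub>R k - h x) < e" if "k \<noteq> 0" "norm k < min d1 d2" for k
      proof (cases "0 < k")
        case True then show ?thesis using d1 that by auto
      next
        case False
        then have "norm ((f x - f (x - (- k))) /\<^sub>R (- k) - h x) < e" using d2(2)[of "-k"] that by auto
        moreover have "(f x - f (x - (- k))) /\<^sub>R (- k) = (f (x + k) - f x) /\<^sub>R k"
          by (simp add: scaleR_diff_right)
        ultimately show ?thesis by simp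
      qed
      then show "\<exists>s>0. \<forall>k. k \<noteq> 0 \<and> norm (k - 0) < s \<longrightarrow> norm ((f (x + k) - f x) /\<^sub>R k - h x) < e"
        using d1(1) d2(1) by (intro exI[of _ "min d1 d2"]) auto
    qed
    then show ?thesis by (simp add: has_vector_derivative_iff_quotient)
  qed
  moreover have "negligible (uminus ` N2)"
    by (rule negligible_locally_Lipschitz_image[OF order_refl N2(1)])
      (rule exI[of _ UNIV], rule exI[of _ 1], auto)
  ultimately show thesis
    by (intro that[of "N1 \<union> uminus ` N2" h]) (use N1(1) h in auto)
qed

section \<open>Total variation\<close>

lemma total_variation_upper:
  assumes "\<And>i. i \<le> k \<Longrightarrow> p i \<in> {a..b}" "\<And>i. i < k \<Longrightarrow> p i \<le> p (Suc i)"
  shows "ereal (\<Sum>i<k. dist (f (p i)) (f (p (Suc i)))) \<le> total_variation f a b"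
  unfolding total_variation_def by (rule SUP_upper2[of "(k, p)"]) (use assms in auto)

lemma total_variation_least:
  assumes "\<And>(k::nat) p. (\<And>i. i \<le> k \<Longrightarrow> p i \<in> {a..b}) \<Longrightarrow> (\<And>i. i < k \<Longrightarrow> p i \<le> p (Suc i)) \<Longrightarrow>
    ereal (\<Sum>i<k. dist (f (p i)) (f (p (Suc i)))) \<le> B"
  shows "total_variation f a b \<le> B"
  unfolding total_variation_def by (rule SUP_least) (use assms in auto)

lemma total_variation_nonneg: "a \<le> b \<Longrightarrow> 0 \<le> total_variation f a b"
  using total_variation_upper[of 0 "\<lambda>_. a" a b f] by (simp add: zero_ereal_def)

text \<open>The increments of \<open>h\<close> telescope along every partition. Later
  \<open>h\<close> is an indefinite integral of the speed, or the parameter minus the elapsed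
  time.\<close>

lemma total_variation_le_increment:
  assumes "\<And>x y. a \<le> x \<Longrightarrow> x \<le> y \<Longrightarrow> y \<le> b \<Longrightarrow> dist (f x) (f y) \<le> h y - h x"
  shows "total_variation f a b \<le> ereal (h b - h a)"
proof (rule total_variation_least)
  fix k :: nat and p :: "nat \<Rightarrow> real"
  assume p: "\<And>i. i \<le> k \<Longrightarrow> p i \<in> {a..b}" "\<And>i. i < k \<Longrightarrow> p i \<le> p (Suc i)"
  have h: "h x \<le> h y" if "a \<le> x" "x \<le> y" "y \<le> b" for x y
    using assms[OF that] zero_le_dist[of "f x" "f y"] by linarith
  have "(\<Sum>i<k. dist (f (p i)) (f (p (Suc i)))) \<le> (\<Sum>i<k. h (p (Suc i)) - h (p i))"
  proof (rule sum_mono)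
    fix i assume "i \<in> {..<k}"
    then show "dist (f (p i)) (f (p (Suc i))) \<le> h (p (Suc i)) - h (p i)"
      using p(1)[of i] p(1)[of "Suc i"] p(2)[of i] by (intro assms) auto
  qed
  also have "\<dots> = h (p k) - h (p 0)" by (rule sum_lessThan_telescope)
  also have "\<dots> \<le> h b - h a"
    using h[of a "p 0"] h[of "p k" b] p(1)[of 0] p(1)[of k] by auto
  finally show "ereal (\<Sum>i<k. dist (f (p i)) (f (p (Suc i)))) \<le> ereal (h b - h a)" by simp
qed

lemma total_variation_add_dist_le:
  assumes "a \<le> b" "b \<le> c"
  shows "total_variation f a b + ereal (dist (f b) (f c)) \<le> total_variation f a c"
proof -
  have "total_variation f a b \<le> total_variation f a c - ereal (dist (f b) (f c))"
  proof (rule total_variation_least)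
    fix k :: nat and p :: "nat \<Rightarrow> real"
    assume p: "\<And>i. i \<le> k \<Longrightarrow> p i \<in> {a..b}" "\<And>i. i < k \<Longrightarrow> p i \<le> p (Suc i)"
    \<comment> \<open>\<open>q\<close> is \<open>p\<close> followed by \<open>b\<close> and
      \<open>c\<close>. The extra term from \<open>p k\<close> to \<open>b\<close> is nonnegative
      and dropped, hence only an inequality below.\<close>
    define q where "q i = (if i \<le> k then p i else if i = Suc k then b else c)" for i
    have "(\<Sum>i<k. dist (f (p i)) (f (p (Suc i)))) = (\<Sum>i<k. dist (f (q i)) (f (q (Suc i))))"
      by (rule sum.cong) (auto simp: q_def)
    then have "(\<Sum>i<k. dist (f (p i)) (f (p (Suc i)))) + dist (f b) (f c)
        \<le> (\<Sum>i<Suc (Suc k). dist (f (q i)) (f (q (Suc i))))"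
      by (simp add: q_def)
    also have "ereal \<dots> \<le> total_variation f a c"
    proof (rule total_variation_upper)
      fix i show "q i \<in> {a..c}" using p(1)[of i] assms by (auto simp: q_def)
    next
      fix i assume "i < Suc (Suc k)"
      then consider "i < k" | "i = k" | "i = Suc k" by linarith
      then show "q i \<le> q (Suc i)"
        using p(1)[of k] p(2)[of i] assms by cases (auto simp: q_def)
    qed
    finally show "ereal (\<Sum>i<k. dist (f (p i)) (f (p (Suc i))))
        \<le> total_variation f a c - ereal (dist (f b) (f c))"
      by (simp add: ereal_le_minus)
  qed
  then show ?thesis by (simp add: ereal_le_minus)
qed

lemma total_variation_subadditive:
  assumes "a \<le> b" "b \<le> c"
  shows "total_variation f a c \<le> total_variation f a b + total_variation f b c"
proof (rule total_variation_least)
  fix k :: nat and p :: "nat \<Rightarrow> real"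
  assume p: "\<And>i. i \<le> k \<Longrightarrow> p i \<in> {a..c}" "\<And>i. i < k \<Longrightarrow> p i \<le> p (Suc i)"
  \<comment> \<open>Clamping a partition to both sides of \<open>b\<close> avoids locating the subinterval that contains \<open>b\<close>.\<close>
  define q r where "q i = min (p i) b" and "r i = max (p i) b" for i
  have "(\<Sum>i<k. dist (f (p i)) (f (p (Suc i))))
      \<le> (\<Sum>i<k. dist (f (q i)) (f (q (Suc i))) + dist (f (r i)) (f (r (Suc i))))"
  proof (rule sum_mono)
    fix i assume "i \<in> {..<k}"
    then have "p i \<le> p (Suc i)" using p by auto
    then show "dist (f (p i)) (f (p (Suc i))) \<le>
        dist (f (q i)) (f (q (Suc i))) + dist (f (r i)) (f (r (Suc i)))"
      using dist_triangle[of "f (p i)" "f (p (Suc i))" "f b"]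
      by (cases "p i \<le> b"; cases "p (Suc i) \<le> b") (auto simp: q_def r_def min_def max_def)
  qed
  then have "ereal (\<Sum>i<k. dist (f (p i)) (f (p (Suc i))))
      \<le> ereal (\<Sum>i<k. dist (f (q i)) (f (q (Suc i)))) + ereal (\<Sum>i<k. dist (f (r i)) (f (r (Suc i))))"
    by (simp add: sum.distrib)
  also have "\<dots> \<le> total_variation f a b + total_variation f b c"
  proof (intro add_mono total_variation_upper)
    fix i assume "i < k"
    then show "q i \<le> q (Suc i)" "r i \<le> r (Suc i)"
      using p(2)[OF \<open>i < k\<close>] by (auto simp: q_def r_def min_def max_def)
  qed (use p assms in \<open>auto simp: q_def r_def le_max_iff_disj min_le_iff_disj\<close>)
  finally show "ereal (\<Sum>i<k. dist (f (p i)) (f (p (Suc i)))) \<le> total_variation f a b + total_variation f b c" .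
qed

text \<open>Real values make differences meaningful. Where the variation is infinite the value is
  the default 0, so the estimates below assume finiteness.\<close>

definition variation_from :: "(real \<Rightarrow> 'a::metric_space) \<Rightarrow> real \<Rightarrow> real \<Rightarrow> real" where
  "variation_from f a s = real_of_ereal (total_variation f a s)"

lemma total_variation_eq_variation_from:
  assumes "a \<le> s" "total_variation f a s < \<infinity>"
  shows "total_variation f a s = ereal (variation_from f a s)"
  using assms total_variation_nonneg[OF assms(1), of f]
  by (cases "total_variation f a s") (auto simp: variation_from_def)

lemma total_variation_mono:
  assumes "a \<le> b" "b \<le> c"
  shows "total_variation f a b \<le> total_variation f a c"
proof -
  have "total_variation f a b + 0 \<le> total_variation f a b + ereal (dist (f b) (f c))"
    by (intro add_left_mono) simp
  also have "\<dots> \<le> total_variation f a c" by (rule total_variation_add_dist_le[OF assms])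
  finally show ?thesis by simp
qed

lemma variation_from_step:
  assumes "a \<le> s" "s \<le> s'" "total_variation f a s' < \<infinity>"
  shows "variation_from f a s + dist (f s) (f s') \<le> variation_from f a s'"
proof -
  have "total_variation f a s < \<infinity>"
    using total_variation_mono[OF assms(1,2), of f] assms(3) by (rule le_less_trans)
  then show ?thesis
    using total_variation_add_dist_le[OF assms(1,2), of f] assms
    by (simp add: total_variation_eq_variation_from)
qed

lemma variation_from_refl [simp]: "variation_from f a a = 0"
proof -
  have "dist (f x) (f y) = 0" if "a \<le> x" "x \<le> y" "y \<le> a" for x y
  proof -
    have "x = y" using that by linarith
    then show ?thesis by simp
  qed
  then have "total_variation f a a \<le> ereal 0"
    using total_variation_le_increment[of a a f "\<lambda>_. 0"] by (metis diff_self order_refl)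
  with total_variation_nonneg[of a a f] show ?thesis
    by (simp add: variation_from_def zero_ereal_def[symmetric] antisym)
qed

lemma variation_from_le_add:
  assumes "a \<le> s" "s \<le> s'" "total_variation f a s' < \<infinity>" "total_variation f s s' \<le> ereal e"
  shows "variation_from f a s' \<le> variation_from f a s + e"
proof -
  have fin: "total_variation f a s < \<infinity>"
    using total_variation_mono[OF assms(1,2), of f] assms(3) by (rule le_less_trans)
  have "total_variation f a s' \<le> total_variation f a s + ereal e"
    using total_variation_subadditive[OF assms(1,2), of f] add_left_mono[OF assms(4)] by (rule order_trans)
  with fin assms show ?thesis by (simp add: total_variation_eq_variation_from)
qed

text \<open>The pieces of a partition of a short interval are disjoint and their lengths add up to
  less than \<open>d\<close>, so the definition of absolute continuity bounds the whole sum, with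
  one \<open>d\<close> for all positions.\<close>

lemma abs_continuous_on_total_variation:
  assumes "abs_continuous_on a b f" "e > 0"
  obtains d where "d > 0"
    "\<And>s s'. a \<le> s \<Longrightarrow> s \<le> s' \<Longrightarrow> s' \<le> b \<Longrightarrow> s' - s < d \<Longrightarrow> total_variation f s s' \<le> ereal e"
proof -
  obtain d where d: "d > 0" "\<And>(k::nat) (p::nat\<Rightarrow>real) q.
      (\<forall>i<k. a \<le> p i \<and> p i \<le> q i \<and> q i \<le> b) \<Longrightarrow> disjoint_family_on (\<lambda>i. {p i<..<q i}) {..<k} \<Longrightarrow>
      (\<Sum>i<k. q i - p i) < d \<Longrightarrow> (\<Sum>i<k. dist (f (p i)) (f (q i))) < e"
    using assms unfolding abs_continuous_on_def by meson
  show thesis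
  proof (rule that[OF d(1)], rule total_variation_least)
    fix s s' k and p :: "nat \<Rightarrow> real"
    assume s: "a \<le> s" "s \<le> s'" "s' \<le> b" "s' - s < d"
      and p: "\<And>i. i \<le> k \<Longrightarrow> p i \<in> {s..s'}" "\<And>i. i < k \<Longrightarrow> p i \<le> p (Suc i)"
    have mono: "p i \<le> p j" if "i \<le> j" "j \<le> k" for i j
      using that(1,2)
    proof (induction j rule: dec_induct)
      case (step n)
      then show ?case using p(2)[of n] by simp
    qed simp
    have "(\<Sum>i<k. dist (f (p i)) (f (p (Suc i)))) < e"
    proof (rule d(2))
      show "\<forall>i<k. a \<le> p i \<and> p i \<le> p (Suc i) \<and> p (Suc i) \<le> b"
      proof (intro allI impI)
        fix i assume "i < k"
        then show "a \<le> p i \<and> p i \<le> p (Suc i) \<and> p (Suc i) \<le> b"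
          using p(1)[of i] p(1)[of "Suc i"] p(2)[of i] s by auto
      qed
      have "{p i<..<p (Suc i)} \<inter> {p j<..<p (Suc j)} = {}" if "i < j" "j < k" for i j
        using mono[of "Suc i" j] that by auto
      then have "{p i<..<p (Suc i)} \<inter> {p j<..<p (Suc j)} = {}" if "i \<noteq> j" "i < k" "j < k" for i j
        using that by (metis Int_commute linorder_neqE_nat)
      then show "disjoint_family_on (\<lambda>i. {p i<..<p (Suc i)}) {..<k}"
        by (auto simp: disjoint_family_on_def)
      show "(\<Sum>i<k. p (Suc i) - p i) < d"
        using p(1)[of 0] p(1)[of k] s by (simp add: sum_lessThan_telescope)
    qed
    then show "ereal (\<Sum>i<k. dist (f (p i)) (f (p (Suc i)))) \<le> ereal e" by simp
  qed
qed

lemma continuous_on_variation_from: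
  assumes ac: "abs_continuous_on a b f" and fin: "total_variation f a b < \<infinity>"
  shows "continuous_on {a..b} (variation_from f a)"
  unfolding continuous_on_iff
proof (intro ballI allI impI)
  fix x and e :: real assume x: "x \<in> {a..b}" and "0 < e"
  \<comment> \<open>The bound on the variation is not strict, whereas continuity asks for a strict
    one; hence \<open>e / 2\<close>.\<close>
  obtain d where d: "d > 0"
    "\<And>s s'. a \<le> s \<Longrightarrow> s \<le> s' \<Longrightarrow> s' \<le> b \<Longrightarrow> s' - s < d \<Longrightarrow> total_variation f s s' \<le> ereal (e / 2)"
    using abs_continuous_on_total_variation[OF ac, of "e / 2"] \<open>0 < e\<close> by auto
  have fin': "total_variation f a s < \<infinity>" if "a \<le> s" "s \<le> b" for s
    using total_variation_mono[OF that, of f] fin by (rule le_less_trans)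
  have "\<bar>variation_from f a s' - variation_from f a s\<bar> < e"
    if "a \<le> s" "s \<le> s'" "s' \<le> b" "s' - s < d" for s s'
  proof -
    have "variation_from f a s' \<le> variation_from f a s + e / 2"
      using that by (intro variation_from_le_add fin' d(2)) auto
    moreover have "variation_from f a s + dist (f s) (f s') \<le> variation_from f a s'"
      using that by (intro variation_from_step fin') auto
    moreover have "0 \<le> dist (f s) (f s')" by simp
    ultimately show ?thesis using \<open>0 < e\<close> by linarith
  qed
  then have "\<forall>y\<in>{a..b}. dist y x < d \<longrightarrow> dist (variation_from f a y) (variation_from f a x) < e"
    using x by (smt (verit) atLeastAtMost_iff dist_real_def)
  with d(1) show "\<exists>d>0. \<forall>y\<in>{a..b}. dist y x < d \<longrightarrow> dist (variation_from f a y) (variation_from f a x) < e"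
    by blast
qed

section \<open>Arc-length parametrization\<close>

text \<open>The product metric is Euclidean and so at most the sum of the two distances. The
  hypothesis uses the sum because the target is \<open>p0' + |p'| = 1\<close>.\<close>

lemma lipschitz_on_Pair_increment:
  fixes p0 :: "real \<Rightarrow> real" and p :: "real \<Rightarrow> 'a::metric_space"
  assumes step: "\<And>r r'. r \<le> r' \<Longrightarrow> p0 r \<le> p0 r' \<and> p0 r' - p0 r + dist (p r) (p r') \<le> r' - r"
  shows "1-lipschitz_on UNIV (\<lambda>s. (p0 s, p s))"
proof (rule lipschitz_on_leI)
  fix x y :: real assume "x \<le> y"
  then have "dist (p0 x, p x) (p0 y, p y) \<le> \<bar>p0 x - p0 y\<bar> + dist (p x) (p y)"
    using sqrt_sum_squares_le_sum_abs[of "dist (p0 x) (p0 y)" "dist (p x) (p y)"]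
    by (simp add: dist_Pair_Pair dist_real_def)
  with step[OF \<open>x \<le> y\<close>] \<open>x \<le> y\<close> show "dist (p0 x, p x) (p0 y, p y) \<le> 1 * dist x y"
    by (simp add: dist_real_def)
qed simp

text \<open>By \<open>tight\<close>, elapsed time and variation together use up the whole parameter
  length, so the deficit \<open>d\<close> between 1 and \<open>p0' + |p'|\<close> has integral at
  most 0 on each \<open>{0..n}\<close>; being nonnegative, it vanishes almost everywhere.\<close>

lemma arclength_parametrization_ae:
  fixes p0 :: "real \<Rightarrow> real" and p :: "real \<Rightarrow> 'a::euclidean_space"
  assumes step: "\<And>r r'. r \<le> r' \<Longrightarrow> p0 r \<le> p0 r' \<and> p0 r' - p0 r + dist (p r) (p r') \<le> r' - r"
    and tight: "\<And>r. 0 \<le> r \<Longrightarrow> ereal (r - (p0 r - p0 0)) \<le> total_variation p 0 r"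
  shows "AE s in lebesgue_on {0..}. p0 differentiable (at s) \<and> p differentiable (at s) \<and>
    deriv p0 s \<ge> 0 \<and> deriv p0 s + norm (vector_derivative p (at s)) = 1"
proof -
  define q where "q s = (p0 s, p s)" for s
  have "1-lipschitz_on UNIV q"
    unfolding q_def[abs_def] using step by (rule lipschitz_on_Pair_increment)
  then obtain h N where N: "negligible N"
    and h_int: "\<And>a b. a \<le> b \<Longrightarrow> (h has_integral (q b - q a)) {a..b}"
    and h_der: "\<And>x. x \<notin> N \<Longrightarrow> (q has_vector_derivative h x) (at x)"
    by (rule lipschitz_ae_derivative) blast
  have der: "(p0 has_vector_derivative fst (h x)) (at x)" "(p has_vector_derivative snd (h x)) (at x)"
    if "x \<notin> N" for x
    using h_der[OF that] bounded_linear.has_vector_derivative[OF bounded_linear_fst, of q]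
      bounded_linear.has_vector_derivative[OF bounded_linear_snd, of q]
    by (auto simp: q_def)
  have cone: "0 \<le> fst (h x) \<and> fst (h x) + norm (snd (h x)) \<le> 1" if "x \<notin> N" for x
  proof -
    \<comment> \<open>For positive increments \<open>step\<close> puts the difference quotients into
      \<open>K\<close>; closedness passes this on to the derivative, for which the limit from the
      right suffices.\<close>
    define K where "K = {z :: real \<times> 'a. 0 \<le> fst z \<and> fst z + norm (snd z) \<le> 1}"
    have "closed K" unfolding K_def
      by (intro closed_Collect_conj closed_Collect_le continuous_intros)
    moreover have "((\<lambda>k. (q (x + k) - q x) /\<^sub>R k) \<longlongrightarrow> h x) (at_right 0)"
      using h_der[OF that] unfolding has_vector_derivative_iff_quotient
      by (rule tendsto_within_subset) simp
    moreover have "\<forall>\<^sub>F k in at_right 0. (q (x + k) - q x) /\<^sub>R k \<in> K"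
      unfolding eventually_at_right_field
    proof (intro exI[of _ 1] conjI allI impI)
      fix k :: real assume "0 < k"
      with step[of x "x + k"] show "(q (x + k) - q x) /\<^sub>R k \<in> K"
        by (auto simp: K_def q_def dist_norm norm_minus_commute divide_simps)
    qed simp
    ultimately have "h x \<in> K"
      by (auto intro: Lim_in_closed_set)
    then show ?thesis by (simp add: K_def)
  qed
  \<comment> \<open>Resetting \<open>h\<close> to 0 on the null set makes the bounds in
    \<open>cone\<close> hold everywhere and leaves all integrals unchanged.\<close>
  define k where "k x = (if x \<in> N then 0 else h x)" for x
  have k_int: "(k has_integral (q b - q a)) {a..b}" if "a \<le> b" for a b
    by (rule has_integral_spike[OF N _ h_int[OF that]]) (simp add: k_def)
  have k_cone: "0 \<le> fst (k x)" "fst (k x) + norm (snd (k x)) \<le> 1" for x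
    using cone by (auto simp: k_def)
  have k1: "((\<lambda>x. fst (k x)) has_integral (p0 b - p0 a)) {a..b}"
    and k2: "((\<lambda>x. snd (k x)) has_integral (p b - p a)) {a..b}" if "a \<le> b" for a b
    using has_integral_linear[OF k_int[OF that] bounded_linear_fst]
      has_integral_linear[OF k_int[OF that] bounded_linear_snd] by (auto simp: o_def q_def)
  have k3: "(\<lambda>x. norm (snd (k x))) integrable_on {a..b}" if "a \<le> b" for a b
  proof -
    have "norm (snd (k x)) \<le> 1" for x
      using k_cone[of x] by linarith
    then have "(\<lambda>x. snd (k x)) absolutely_integrable_on {a..b}"
      by (intro absolutely_integrable_integrable_bound[of _ _ "\<lambda>_. 1"]) (use k2[OF that] in auto)
    then show ?thesis by (simp add: absolutely_integrable_on_def)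
  qed
  define d where "d x = 1 - fst (k x) - norm (snd (k x))" for x
  have d_nonneg: "0 \<le> d x" for x
    using k_cone(2)[of x] by (simp add: d_def)
  have "AE x in lebesgue. x \<in> {0..real n} \<longrightarrow> d x = 0" for n
  proof -
    define H where "H x = integral {0..x} (\<lambda>x. norm (snd (k x)))" for x
    have "total_variation p 0 (real n) \<le> ereal (H n - H 0)"
    proof (rule total_variation_le_increment)
      fix x y assume xy: "0 \<le> x" "x \<le> y" "y \<le> real n"
      have "dist (p x) (p y) = norm (integral {x..y} (\<lambda>x. snd (k x)))"
        using k2[OF xy(2)] by (simp add: integral_unique dist_norm norm_minus_commute)
      also have "\<dots> \<le> integral {x..y} (\<lambda>x. norm (snd (k x)))"
        using k2[OF xy(2)] k3[OF xy(2)] by (intro integral_norm_bound_integral) auto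
      also have "\<dots> = H y - H x"
        using Henstock_Kurzweil_Integration.integral_combine[OF xy(1,2) k3] xy by (simp add: H_def)
      finally show "dist (p x) (p y) \<le> H y - H x" .
    qed
    \<comment> \<open>The variation is bounded below by \<open>tight\<close> and above by
      \<open>H n\<close>, the integral of \<open>norm (snd (k x))\<close>; together these make the
      integral of \<open>d\<close> nonpositive.\<close>
    with tight[of "real n"] have "real n - (p0 n - p0 0) \<le> H n"
      by (simp add: H_def) (meson ereal_less_eq(3) order_trans)
    moreover have d_int: "(d has_integral (real n - 0 - (p0 n - p0 0) - H n)) {0..real n}"
      unfolding d_def H_def
      by (intro has_integral_diff k1 integrable_integral k3) (use has_integral_const_real[of "1::real" 0 "real n"] in auto)
    ultimately have "integral {0..real n} d \<le> 0"
      by (simp add: integral_unique)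
    moreover have "0 \<le> integral {0..real n} d"
      using d_int d_nonneg by (intro integral_nonneg) auto
    ultimately have "integral {0..real n} d = 0" by simp
    moreover have ai: "d absolutely_integrable_on {0..real n}"
      using d_int d_nonneg by (intro nonnegative_absolutely_integrable_1) auto
    ultimately have "integral\<^sup>L (lebesgue_on {0..real n}) d = 0"
      by (subst lebesgue_integral_eq_integral) (auto intro: absolutely_integrable_imp_integrable)
    then have "AE x in lebesgue_on {0..real n}. d x = 0"
      by (subst (asm) integral_nonneg_eq_0_iff_AE)
        (auto intro: absolutely_integrable_imp_integrable ai d_nonneg)
    then show ?thesis by (simp add: AE_restrict_space_iff)
  qed
  then have "AE x in lebesgue. \<forall>n. x \<in> {0..real n} \<longrightarrow> d x = 0"
    unfolding AE_all_countable by blast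
  moreover have "AE x in lebesgue. x \<notin> N"
    using N by (simp add: negligible_iff_null_sets AE_not_in)
  ultimately have "AE s in lebesgue. s \<in> {0..} \<longrightarrow> p0 differentiable (at s) \<and> p differentiable (at s) \<and>
    deriv p0 s \<ge> 0 \<and> deriv p0 s + norm (vector_derivative p (at s)) = 1"
  proof eventually_elim
    case (elim s)
    show ?case
    proof
      assume "s \<in> {0..}"
      moreover obtain n :: nat where "s \<le> n" using real_arch_simple by blast
      ultimately have "d s = 0" using elim(1) by auto
      moreover have "deriv p0 s = fst (h s)"
        using der(1)[OF elim(2)] by (simp add: DERIV_imp_deriv has_real_derivative_iff_has_vector_derivative)
      moreover have "vector_derivative p (at s) = snd (h s)"
        using der(2)[OF elim(2)] by (rule vector_derivative_at)
      moreover have "p0 differentiable (at s)" "p differentiable (at s)"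
        using der[OF elim(2)] by (auto intro: differentiableI_vector)
      ultimately show "p0 differentiable (at s) \<and> p differentiable (at s) \<and>
        deriv p0 s \<ge> 0 \<and> deriv p0 s + norm (vector_derivative p (at s)) = 1"
        using cone[OF elim(2)] elim(2) by (simp add: d_def k_def)
    qed
  qed
  then show ?thesis by (subst AE_restrict_space_iff) simp_all
qed

section \<open>Whitney paths in Lipschitz parametrization\<close>

text \<open>Parametrized by its own variation \<open>l\<close>, the path becomes 1-Lipschitz. By
  absolute continuity \<open>l\<close> is continuous and takes every value up to \<open>l 1\<close>;
  where \<open>l\<close> is constant so is \<open>w\<close>, so any choice of preimages is
  good.\<close>

lemma abs_continuous_rectifiable_reparametrization:
  assumes ac: "abs_continuous_on 0 1 w" and fin: "total_variation w 0 1 \<le> ereal (b - a)"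
    and w: "w \<in> {0..1} \<rightarrow> U"
  shows "\<exists>p. p a = w 0 \<and> p b = w 1 \<and> p \<in> {a..b} \<rightarrow> U \<and> 1-lipschitz_on {a..b} p"
proof -
  have fin1: "total_variation w 0 1 < \<infinity>"
    using fin by (rule le_less_trans) simp
  then have fin': "total_variation w 0 s < \<infinity>" if "0 \<le> s" "s \<le> 1" for s
    using total_variation_mono[OF that, of w] by (rule le_less_trans[rotated])
  define l where "l = variation_from w 0"
  have l_step: "dist (w s) (w s') \<le> l s' - l s" if "0 \<le> s" "s \<le> s'" "s' \<le> 1" for s s'
    using variation_from_step[OF that(1,2) fin'] that by (auto simp: l_def)
  then have l_dist: "dist (w s) (w s') \<le> \<bar>l s' - l s\<bar>" if "0 \<le> s" "s \<le> 1" "0 \<le> s'" "s' \<le> 1" for s s'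
    using that by (smt (verit) dist_commute)
  have l0: "l 0 = 0" by (simp add: l_def)
  have l1: "l 1 \<le> b - a" "0 \<le> l 1"
  proof -
    show "l 1 \<le> b - a"
      using fin unfolding total_variation_eq_variation_from[OF zero_le_one fin1] l_def by simp
    show "0 \<le> l 1"
      using l_step[of 0 1] zero_le_dist[of "w 0" "w 1"] l0 by linarith
  qed
  have "\<exists>s. 0 \<le> s \<and> s \<le> 1 \<and> l s = r" if "0 \<le> r" "r \<le> l 1" for r
    using IVT'[of l 0 r 1] that continuous_on_variation_from[OF ac fin1] by (auto simp: l0 l_def)
  then obtain \<sigma> where \<sigma>: "\<And>r. 0 \<le> r \<Longrightarrow> r \<le> l 1 \<Longrightarrow> 0 \<le> \<sigma> r \<and> \<sigma> r \<le> 1 \<and> l (\<sigma> r) = r"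
    by metis
  \<comment> \<open>The interval may be longer than \<open>l 1\<close>; the path then rests at its
    endpoint.\<close>
  define p where "p r = w (\<sigma> (min (r - a) (l 1)))" for r
  have "p a = w 0"
    using l_dist[of "\<sigma> 0" 0] \<sigma>[of 0] l1 by (simp add: p_def l0)
  moreover have "p b = w 1"
    using l_dist[of "\<sigma> (l 1)" 1] \<sigma>[of "l 1"] l1 by (simp add: p_def min_absorb2)
  moreover have "p \<in> {a..b} \<rightarrow> U"
    using w \<sigma> l1 by (auto simp: p_def Pi_iff)
  moreover have "1-lipschitz_on {a..b} p"
  proof (rule lipschitz_onI)
    fix x y assume xy: "x \<in> {a..b}" "y \<in> {a..b}"
    define x' y' where "x' = min (x - a) (l 1)" and "y' = min (y - a) (l 1)"
    have "dist (p x) (p y) \<le> \<bar>l (\<sigma> y') - l (\<sigma> x')\<bar>"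
      unfolding p_def x'_def[symmetric] y'_def[symmetric]
      using \<sigma>[of x'] \<sigma>[of y'] xy l1 by (intro l_dist) (auto simp: x'_def y'_def)
    also have "\<dots> = \<bar>y' - x'\<bar>"
      using \<sigma>[of x'] \<sigma>[of y'] xy l1 by (auto simp: x'_def y'_def)
    also have "\<dots> \<le> 1 * dist x y"
      by (auto simp: x'_def y'_def dist_real_def min_def)
    finally show "dist (p x) (p y) \<le> 1 * dist x y" .
  qed simp
  ultimately show ?thesis by blast
qed

lemma whitney_property_lipschitz_paths:
  assumes "whitney_property U"
  obtains C where "C \<ge> 1" "\<And>x y a b. \<lbrakk>x \<in> U; y \<in> U; C * dist x y \<le> b - a\<rbrakk> \<Longrightarrow>
    \<exists>p. p a = x \<and> p b = y \<and> p \<in> {a..b} \<rightarrow> U \<and> 1-lipschitz_on {a..b} p"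
proof -
  obtain C where C: "C \<ge> 1" "\<And>x y. x \<in> U \<Longrightarrow> y \<in> U \<Longrightarrow> \<exists>w. abs_continuous_on 0 1 w \<and> w \<in> {0..1} \<rightarrow> U \<and>
      w 0 = x \<and> w 1 = y \<and> total_variation w 0 1 \<le> ereal (C * dist x y)"
    using assms unfolding whitney_property_def dist_norm by blast
  show thesis
  proof (rule that[OF C(1)])
    fix x y a b assume xy: "x \<in> U" "y \<in> U" and ab: "C * dist x y \<le> b - a"
    obtain w where w: "abs_continuous_on 0 1 w" "w \<in> {0..1} \<rightarrow> U" "w 0 = x" "w 1 = y"
      "total_variation w 0 1 \<le> ereal (C * dist x y)" using C(2)[OF xy] by blast
    have "total_variation w 0 1 \<le> ereal (b - a)"
      using w(5) ab by (meson ereal_less_eq(3) order_trans)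
    from abs_continuous_rectifiable_reparametrization[OF w(1) this w(2)] w(3,4)
    show "\<exists>p. p a = x \<and> p b = y \<and> p \<in> {a..b} \<rightarrow> U \<and> 1-lipschitz_on {a..b} p" by simp
  qed
qed

section \<open>Curves reparametrized by arc length\<close>

text \<open>Distances along \<open>\<gamma>\<close> are at most increments of
  \<open>s - \<gamma>0 s\<close>, so the variation over an interval is finite and at most its length
  minus the elapsed time. This bounds the growth of arc length from above; the distance of the
  endpoints bounds it from below.\<close>

lemma arclength_step:
  assumes step: "\<And>s s'. 0 \<le> s \<Longrightarrow> s \<le> s' \<Longrightarrow> \<gamma>0 s \<le> \<gamma>0 s' \<and> \<gamma>0 s' - \<gamma>0 s + dist (\<gamma> s) (\<gamma> s') \<le> s' - (s::real)"
    and s: "0 \<le> s" "s \<le> s'"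
  shows "\<gamma>0 s' - \<gamma>0 s + dist (\<gamma> s) (\<gamma> s')
      \<le> (\<gamma>0 s' + variation_from \<gamma> 0 s') - (\<gamma>0 s + variation_from \<gamma> 0 s)" (is ?A)
    and "(\<gamma>0 s' + variation_from \<gamma> 0 s') - (\<gamma>0 s + variation_from \<gamma> 0 s) \<le> s' - s" (is ?B)
    and "total_variation \<gamma> 0 s < \<infinity>" (is ?C)
proof -
  have tv: "total_variation \<gamma> a b \<le> ereal ((b - \<gamma>0 b) - (a - \<gamma>0 a))" if "0 \<le> a" for a b
  proof (rule total_variation_le_increment)
    fix x y assume "a \<le> x" "x \<le> y" "y \<le> b"
    then show "dist (\<gamma> x) (\<gamma> y) \<le> (y - \<gamma>0 y) - (x - \<gamma>0 x)" using step[of x y] that by auto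
  qed
  then have fin: "total_variation \<gamma> 0 b < \<infinity>" for b
    by (rule le_less_trans) auto
  show ?C by (rule fin)
  show ?A using variation_from_step[OF s fin] by simp
  show ?B using variation_from_le_add[OF s fin tv[OF s(1)]] by simp
qed

text \<open>\<open>l\<close> is continuous, starts at 0 and is unbounded, hence reaches every
  nonnegative value. Parameters with equal \<open>l\<close> give the same point, so composing the
  curve with any right inverse \<open>\<sigma>\<close> of \<open>l\<close> is consistent.\<close>

lemma arclength_reparametrization:
  fixes \<gamma>0 :: "real \<Rightarrow> real" and \<gamma> :: "real \<Rightarrow> 'a::metric_space"
  defines "l \<equiv> \<lambda>s. \<gamma>0 s + variation_from \<gamma> 0 s"
  assumes step: "\<And>s s'. 0 \<le> s \<Longrightarrow> s \<le> s' \<Longrightarrow> \<gamma>0 s \<le> \<gamma>0 s' \<and> \<gamma>0 s' - \<gamma>0 s + dist (\<gamma> s) (\<gamma> s') \<le> s' - s"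
    and start: "\<gamma>0 0 = 0"
    and unbounded: "\<And>r. \<exists>s\<ge>0. r \<le> l s"
  obtains \<phi>0 \<phi> where
    "\<And>r r'. r \<le> r' \<Longrightarrow> \<phi>0 r \<le> \<phi>0 r' \<and> \<phi>0 r' - \<phi>0 r + dist (\<phi> r) (\<phi> r') \<le> r' - r"
    "\<And>r. 0 \<le> r \<Longrightarrow> ereal (r - (\<phi>0 r - \<phi>0 0)) \<le> total_variation \<phi> 0 r"
    "\<And>s. 0 \<le> s \<Longrightarrow> \<phi>0 (l s) = \<gamma>0 s \<and> \<phi> (l s) = \<gamma> s"
    "\<And>r. \<exists>s\<ge>0. \<phi>0 r = \<gamma>0 s \<and> \<phi> r = \<gamma> s"
proof -
  have l_lower: "\<gamma>0 s' - \<gamma>0 s + dist (\<gamma> s) (\<gamma> s') \<le> l s' - l s"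
    and l_upper: "l s' - l s \<le> s' - s" if "0 \<le> s" "s \<le> s'" for s s'
    unfolding l_def by (rule arclength_step(1,2)[OF _ that], rule step, assumption+)+
  have fin: "total_variation \<gamma> 0 s < \<infinity>" if "0 \<le> s" for s
    by (rule arclength_step(3)[OF _ that order_refl], rule step)
  have l_mono: "l s \<le> l s'" if "0 \<le> s" "s \<le> s'" for s s'
    using l_lower[OF that] step[OF that] zero_le_dist[of "\<gamma> s" "\<gamma> s'"] by linarith
  have l0: "l 0 = 0" by (simp add: l_def start)
  have l_cont: "continuous_on {0..s} l" for s
  proof (rule lipschitz_on_continuous_on)
    show "1-lipschitz_on {0..s} l"
    proof (rule lipschitz_on_leI)
      fix x y assume "x \<in> {0..s}" "y \<in> {0..s}" "x \<le> y"
      then show "dist (l x) (l y) \<le> 1 * dist x y"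
        using l_mono[of x y] l_upper[of x y] by (simp add: dist_real_def)
    qed simp
  qed
  have l_inj: "\<gamma>0 s = \<gamma>0 s' \<and> \<gamma> s = \<gamma> s'" if "0 \<le> s" "0 \<le> s'" "l s = l s'" for s s'
  proof -
    have *: "\<gamma>0 a = \<gamma>0 b \<and> \<gamma> a = \<gamma> b" if "0 \<le> a" "a \<le> b" "l a = l b" for a b
    proof -
      have "dist (\<gamma> a) (\<gamma> b) = 0" "\<gamma>0 a = \<gamma>0 b"
        using l_lower[OF that(1,2)] step[OF that(1,2)] that(3) zero_le_dist[of "\<gamma> a" "\<gamma> b"] by linarith+
      then show ?thesis by simp
    qed
    show ?thesis
    proof (cases "s \<le> s'")
      case True
      then show ?thesis by (intro * that)
    next
      case False
      then have "\<gamma>0 s' = \<gamma>0 s \<and> \<gamma> s' = \<gamma> s" using that by (intro *) auto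
      then show ?thesis by simp
    qed
  qed
  have "\<exists>s\<ge>0. l s = r" if "0 \<le> r" for r
  proof -
    obtain s where "0 \<le> s" "r \<le> l s" using unbounded by blast
    then show ?thesis using IVT'[of l 0 r s] l_cont l0 that by auto
  qed
  then obtain \<sigma> where \<sigma>: "\<And>r. 0 \<le> r \<Longrightarrow> 0 \<le> \<sigma> r \<and> l (\<sigma> r) = r" by metis
  \<comment> \<open>\<open>max r 0\<close> keeps the curve constant on the negative half-line, since
    the Lipschitz theory above works on the whole line.\<close>
  define \<phi>0 \<phi> where "\<phi>0 r = \<gamma>0 (\<sigma> (max r 0))" and "\<phi> r = \<gamma> (\<sigma> (max r 0))" for r
  have \<phi>_l: "\<phi>0 (l s) = \<gamma>0 s \<and> \<phi> (l s) = \<gamma> s" if "0 \<le> s" for s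
    using l_inj[of "\<sigma> (l s)" s] \<sigma>[of "l s"] l_mono[of 0 s] l0 that
    by (simp add: \<phi>0_def \<phi>_def max_absorb1)
  show thesis
  proof (rule that[OF _ _ \<phi>_l])
    fix r
    show "\<exists>s\<ge>0. \<phi>0 r = \<gamma>0 s \<and> \<phi> r = \<gamma> s"
      using \<sigma>[of "max r 0"] by (auto simp: \<phi>0_def \<phi>_def)
  next
    fix r r' :: real assume "r \<le> r'"
    define a b where "a = max r 0" and "b = max r' 0"
    have ab: "0 \<le> a" "a \<le> b" "b - a \<le> r' - r" "0 \<le> b"
      using \<open>r \<le> r'\<close> by (auto simp: a_def b_def)
    show "\<phi>0 r \<le> \<phi>0 r' \<and> \<phi>0 r' - \<phi>0 r + dist (\<phi> r) (\<phi> r') \<le> r' - r"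
    proof (cases "a = b")
      case True
      then show ?thesis using \<open>r \<le> r'\<close> by (simp add: \<phi>0_def \<phi>_def a_def b_def)
    next
      case False
      then have "\<sigma> a \<le> \<sigma> b"
        using l_mono[of "\<sigma> b" "\<sigma> a"] \<sigma>[OF ab(1)] \<sigma>[OF ab(4)] ab by linarith
      then show ?thesis
        using l_lower[of "\<sigma> a" "\<sigma> b"] step[of "\<sigma> a" "\<sigma> b"] \<sigma>[OF ab(1)] \<sigma>[OF ab(4)] ab
        by (simp add: \<phi>0_def \<phi>_def a_def[symmetric] b_def[symmetric])
    qed
  next
    fix r :: real assume r: "0 \<le> r"
    define s where "s = \<sigma> r"
    have s: "0 \<le> s" "l s = r" using \<sigma>[OF r] by (auto simp: s_def)
    have "r - (\<phi>0 r - \<phi>0 0) = variation_from \<gamma> 0 s"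
      using \<phi>_l[OF s(1)] \<phi>_l[of 0] s l0 start by (simp add: l_def)
    then have "ereal (r - (\<phi>0 r - \<phi>0 0)) = total_variation \<gamma> 0 s"
      using total_variation_eq_variation_from[OF s(1) fin[OF s(1)]] by simp
    \<comment> \<open>The monotone map \<open>l\<close> carries partitions of \<open>{0..s}\<close>
      to partitions of \<open>{0..r}\<close> with the same sum, so no variation is lost.\<close>
    also have "\<dots> \<le> total_variation \<phi> 0 r"
    proof (rule total_variation_least)
      fix k :: nat and p :: "nat \<Rightarrow> real"
      assume p: "\<And>i. i \<le> k \<Longrightarrow> p i \<in> {0..s}" "\<And>i. i < k \<Longrightarrow> p i \<le> p (Suc i)"
      have "(\<Sum>i<k. dist (\<gamma> (p i)) (\<gamma> (p (Suc i)))) = (\<Sum>i<k. dist (\<phi> (l (p i))) (\<phi> (l (p (Suc i)))))"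
      proof (rule sum.cong)
        fix i assume "i \<in> {..<k}"
        then show "dist (\<gamma> (p i)) (\<gamma> (p (Suc i))) = dist (\<phi> (l (p i))) (\<phi> (l (p (Suc i))))"
          using \<phi>_l[of "p i"] \<phi>_l[of "p (Suc i)"] p(1)[of i] p(1)[of "Suc i"] by simp
      qed simp
      also have "ereal \<dots> \<le> total_variation \<phi> 0 r"
      proof (rule total_variation_upper)
        fix i assume "i \<le> k"
        then show "l (p i) \<in> {0..r}"
          using p(1)[of i] l_mono[of 0 "p i"] l_mono[of "p i" s] l0 s by auto
      next
        fix i assume "i < k"
        then show "l (p i) \<le> l (p (Suc i))"
          using p(1)[of i] p(2)[of i] by (intro l_mono) auto
      qed
      finally show "ereal (\<Sum>i<k. dist (\<gamma> (p i)) (\<gamma> (p (Suc i)))) \<le> total_variation \<phi> 0 r" .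
    qed
    finally show "ereal (r - (\<phi>0 r - \<phi>0 0)) \<le> total_variation \<phi> 0 r" .
  qed
qed

section \<open>Curves through a graph with gaps\<close>

text \<open>A triple \<open>(s, t, x)\<close> prescribes time \<open>t\<close> and value
  \<open>x\<close> at parameter \<open>s\<close>. The factor \<open>C\<close> in
  \<open>R_step\<close> leaves room for a Whitney path in each gap; \<open>R_unbounded\<close> gives
  each parameter a right neighbour.\<close>

lemma lipschitz_curve_through:
  fixes R :: "(real \<times> real \<times> 'a::metric_space) set"
  assumes U: "compact U" and C: "C \<ge> 1"
    and path: "\<And>x y a b. \<lbrakk>x \<in> U; y \<in> U; C * dist x y \<le> b - a\<rbrakk> \<Longrightarrow>
      \<exists>p. p a = x \<and> p b = y \<and> p \<in> {a..b} \<rightarrow> U \<and> 1-lipschitz_on {a..b} p"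
    and R_sub: "R \<subseteq> {0..} \<times> {0..T} \<times> U"
    and R_step: "\<And>s t x s' t' x'. (s, t, x) \<in> R \<Longrightarrow> (s', t', x') \<in> R \<Longrightarrow> s \<le> s' \<Longrightarrow>
      t \<le> t' \<and> t' - t + C * dist x x' \<le> s' - s"
    and R_start: "(0, 0, x0) \<in> R"
    and R_time: "\<And>t. 0 \<le> t \<Longrightarrow> t < T \<Longrightarrow> \<exists>s x. (s, t, x) \<in> R"
    and R_unbounded: "\<And>r. \<exists>s t x. (s, t, x) \<in> R \<and> r \<le> s"
  obtains \<gamma>0 \<gamma> where
    "\<And>r r'. 0 \<le> r \<Longrightarrow> r \<le> r' \<Longrightarrow> \<gamma>0 r \<le> \<gamma>0 r' \<and> \<gamma>0 r' - \<gamma>0 r + dist (\<gamma> r) (\<gamma> r') \<le> r' - r"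
    "\<And>r. 0 \<le> r \<Longrightarrow> \<gamma>0 r \<in> {0..T} \<and> \<gamma> r \<in> U"
    "\<And>s t x. (s, t, x) \<in> R \<Longrightarrow> \<gamma>0 s = t \<and> \<gamma> s = x"
proof -
  \<comment> \<open>Every \<open>r\<close> lies between a nearest point \<open>L r\<close> to the left and \<open>H r\<close> to the right in the closure of \<open>R\<close>;
    since \<open>R\<close> meets all times, no time is skipped across a gap, which a Whitney path can therefore fill.\<close>
  define Q where "Q = closure R"
  have RQ: "R \<subseteq> Q" unfolding Q_def by (rule closure_subset)
  have Q_sub: "Q \<subseteq> {0..} \<times> {0..T} \<times> U"
    unfolding Q_def using R_sub U
    by (intro closure_minimal closed_Times) (auto intro: compact_imp_closed)
  have Q_step: "t \<le> t' \<and> t' - t + C * dist x x' \<le> s' - s"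
    if Q: "(s, t, x) \<in> Q" "(s', t', x') \<in> Q" and ss: "s \<le> s'" for s t x s' t' x'
  proof -
    \<comment> \<open>The hypothesis on \<open>R\<close> without the case distinction \<open>s \<le> s'\<close>, as a closed condition.\<close>
    define Z where "Z = {z :: (real \<times> real \<times> 'a) \<times> (real \<times> real \<times> 'a).
      0 \<le> (fst (snd z) - fst (fst z)) * (fst (snd (snd z)) - fst (snd (fst z))) \<and>
      \<bar>fst (snd (snd z)) - fst (snd (fst z))\<bar> + C * dist (snd (snd (fst z))) (snd (snd (snd z)))
        \<le> \<bar>fst (snd z) - fst (fst z)\<bar>}"
    have "closed Z" unfolding Z_def
      by (intro closed_Collect_conj closed_Collect_le continuous_intros)
    moreover have "R \<times> R \<subseteq> Z"
    proof clarify
      fix s t x s' t' x' assume R: "(s, t, x) \<in> R" "(s', t', x') \<in> R"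
      show "((s, t, x), (s', t', x')) \<in> Z"
      proof (cases "s \<le> s'")
        case True
        then show ?thesis using R_step[OF R] by (auto simp: Z_def)
      next
        case False
        then show ?thesis using R_step[OF R(2,1)]
          by (auto simp: Z_def dist_commute mult_nonpos_nonpos)
      qed
    qed
    ultimately have "Q \<times> Q \<subseteq> Z" unfolding Q_def closure_Times[symmetric] by (rule closure_minimal[rotated])
    then have z: "0 \<le> (s' - s) * (t' - t)" "\<bar>t' - t\<bar> + C * dist x x' \<le> s' - s"
      using Q ss by (auto simp: Z_def)
    have "0 \<le> C * dist x x'" using C by simp
    have "t \<le> t'"
    proof (cases "s = s'")
      case True
      then show ?thesis using z(2) \<open>0 \<le> C * dist x x'\<close> by linarith
    next
      case False
      then show ?thesis using z(1) ss by (simp add: zero_le_mult_iff)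
    qed
    with z(2) show ?thesis by simp
  qed
  \<comment> \<open>Between equal parameters the step condition leaves no room for a change of time
    or value: \<open>Q\<close> is the graph of a function of the parameter.\<close>
  have Q_uniq: "z = z'" if "z \<in> Q" "z' \<in> Q" "fst z = fst z'" for z z'
  proof -
    obtain s t x s' t' x' where zz: "z = (s, t, x)" "z' = (s', t', x')" by (metis prod.exhaust)
    have "1 * dist x x' \<le> C * dist x x'" using C by (rule mult_right_mono) simp
    moreover have "t \<le> t'" "t' \<le> t" "t' - t + C * dist x x' \<le> 0"
      using Q_step[of s t x s' t' x'] Q_step[of s' t' x' s t x] that zz by auto
    ultimately have "t = t'" "dist x x' \<le> 0" by linarith+
    then show ?thesis using that zz by simp
  qed
  \<comment> \<open>Cut off in the parameter, \<open>Q\<close> is compact because \<open>U\<close>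
    is, so nearest points exist.\<close>
  have Q_compact: "compact (Q \<inter> {a..b} \<times> {0..T} \<times> U)" for a b
    using U by (intro closed_Int_compact compact_Times) (auto simp: Q_def)
  have "\<exists>z\<in>Q. fst z \<le> r \<and> (\<forall>y\<in>Q. fst y \<le> r \<longrightarrow> fst y \<le> fst z)" if "0 \<le> r" for r
  proof -
    have "(0, 0, x0) \<in> Q \<inter> {0..r} \<times> {0..T} \<times> U"
      using R_start RQ R_sub that by auto
    then have "\<exists>z\<in>Q \<inter> {0..r} \<times> {0..T} \<times> U. \<forall>y\<in>Q \<inter> {0..r} \<times> {0..T} \<times> U. fst y \<le> fst z"
      by (intro continuous_attains_sup Q_compact continuous_intros) auto
    then obtain z where z: "z \<in> Q \<inter> {0..r} \<times> {0..T} \<times> U"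
      "\<And>y. y \<in> Q \<inter> {0..r} \<times> {0..T} \<times> U \<Longrightarrow> fst y \<le> fst z" by blast
    then have "z \<in> Q" "fst z \<le> r" by auto
    moreover
    have "y \<in> Q \<inter> {0..r} \<times> {0..T} \<times> U" if "y \<in> Q" "fst y \<le> r" for y
      using that Q_sub by (cases y) auto
    ultimately show ?thesis using z(2) by blast
  qed
  then obtain L where L: "\<And>r. 0 \<le> r \<Longrightarrow> L r \<in> Q"
    "\<And>r. 0 \<le> r \<Longrightarrow> fst (L r) \<le> r" "\<And>r y. 0 \<le> r \<Longrightarrow> y \<in> Q \<Longrightarrow> fst y \<le> r \<Longrightarrow> fst y \<le> fst (L r)"
    by metis
  have "\<exists>z\<in>Q. r \<le> fst z \<and> (\<forall>y\<in>Q. r \<le> fst y \<longrightarrow> fst z \<le> fst y)" if "0 \<le> r" for r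
  proof -
    obtain s t x where R: "(s, t, x) \<in> R" "r \<le> s" using R_unbounded by blast
    then have "(s, t, x) \<in> Q \<inter> {r..s} \<times> {0..T} \<times> U"
      using RQ R_sub by auto
    then have "\<exists>z\<in>Q \<inter> {r..s} \<times> {0..T} \<times> U. \<forall>y\<in>Q \<inter> {r..s} \<times> {0..T} \<times> U. fst z \<le> fst y"
      by (intro continuous_attains_inf Q_compact continuous_intros) auto
    then obtain z where z: "z \<in> Q \<inter> {r..s} \<times> {0..T} \<times> U"
      "\<And>y. y \<in> Q \<inter> {r..s} \<times> {0..T} \<times> U \<Longrightarrow> fst z \<le> fst y" by blast
    then have "z \<in> Q" "r \<le> fst z" "fst z \<le> s" by auto
    moreover
    have "y \<in> Q \<inter> {r..s} \<times> {0..T} \<times> U" if "y \<in> Q" "r \<le> fst y" "fst y \<le> s" for y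
      using that Q_sub by (cases y) auto
    ultimately show ?thesis using z(2) by (meson linear order_trans)
  qed
  then obtain H where H: "\<And>r. 0 \<le> r \<Longrightarrow> H r \<in> Q"
    "\<And>r. 0 \<le> r \<Longrightarrow> r \<le> fst (H r)" "\<And>r y. 0 \<le> r \<Longrightarrow> y \<in> Q \<Longrightarrow> r \<le> fst y \<Longrightarrow> fst (H r) \<le> fst y"
    by metis
  have LH_time: "fst (snd (L r)) = fst (snd (H r))" if r: "0 \<le> r" for r
  proof (rule ccontr)
    obtain a t x b t' x' where LH: "L r = (a, t, x)" "H r = (b, t', x')" by (metis prod.exhaust)
    have Q: "(a, t, x) \<in> Q" "(b, t', x') \<in> Q" "a \<le> r" "r \<le> b"
      using L(1,2)[OF r] H(1,2)[OF r] LH by auto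
    assume "fst (snd (L r)) \<noteq> fst (snd (H r))"
    then have "t < t'" using Q_step[OF Q(1,2)] Q LH by auto
    \<comment> \<open>A point of \<open>R\<close> at time \<open>m\<close> would have its parameter
      strictly between \<open>a\<close> and \<open>b\<close>, where \<open>Q\<close> has no
      points.\<close>
    define m where "m = (t + t') / 2"
    have m: "t < m" "m < t'" using \<open>t < t'\<close> by (auto simp: m_def)
    moreover have "0 \<le> t" "t' \<le> T" using Q Q_sub by auto
    ultimately obtain s y where "(s, m, y) \<in> R" using R_time[of m] by auto
    then have sQ: "(s, m, y) \<in> Q" using RQ by auto
    then have "\<not> s \<le> a" "\<not> b \<le> s"
      using Q_step[OF sQ Q(1)] Q_step[OF Q(2) sQ] m by auto
    moreover have "s \<le> a \<or> b \<le> s"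
      using L(3)[OF r sQ] H(3)[OF r sQ] LH by (cases "s \<le> r") auto
    ultimately show False by blast
  qed
  define joins where "joins z z' p \<longleftrightarrow> p (fst z) = snd (snd z) \<and> p (fst z') = snd (snd z') \<and>
      p \<in> {fst z..fst z'} \<rightarrow> U \<and> 1-lipschitz_on {fst z..fst z'} p"
    for z z' :: "real \<times> real \<times> 'a" and p
  \<comment> \<open>\<open>SOME\<close> depends on the endpoints only, so all parameters in one gap
    share a single path.\<close>
  define P where "P z z' = (SOME p. joins z z' p)" for z z'
  define \<gamma>0 \<gamma> where "\<gamma>0 r = fst (snd (L r))" and "\<gamma> r = P (L r) (H r) r" for r
  have P_LH: "P (L r) (H r) (fst (L r)) = snd (snd (L r))" "P (L r) (H r) (fst (H r)) = snd (snd (H r))"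
    "P (L r) (H r) \<in> {fst (L r)..fst (H r)} \<rightarrow> U" "1-lipschitz_on {fst (L r)..fst (H r)} (P (L r) (H r))"
    if r: "0 \<le> r" for r
  proof -
    have "C * dist (snd (snd (L r))) (snd (snd (H r))) \<le> fst (H r) - fst (L r)"
      using Q_step[of "fst (L r)" "fst (snd (L r))" "snd (snd (L r))" "fst (H r)" "fst (snd (H r))" "snd (snd (H r))"]
        L(1,2)[OF r] H(1,2)[OF r] by auto
    moreover have "snd (snd (L r)) \<in> U" "snd (snd (H r)) \<in> U"
      using L(1)[OF r] H(1)[OF r] Q_sub by auto
    ultimately have "\<exists>p. joins (L r) (H r) p" unfolding joins_def by (intro path)
    then have "joins (L r) (H r) (P (L r) (H r))" unfolding P_def by (rule someI_ex)
    then show "P (L r) (H r) (fst (L r)) = snd (snd (L r))" "P (L r) (H r) (fst (H r)) = snd (snd (H r))"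
      "P (L r) (H r) \<in> {fst (L r)..fst (H r)} \<rightarrow> U" "1-lipschitz_on {fst (L r)..fst (H r)} (P (L r) (H r))"
      by (simp_all add: joins_def)
  qed
  show thesis
  proof (rule that)
    fix r :: real assume r: "0 \<le> r"
    show "\<gamma>0 r \<in> {0..T} \<and> \<gamma> r \<in> U"
      using L(1,2)[OF r] H(2)[OF r] Q_sub P_LH(3)[OF r] by (auto simp: \<gamma>0_def \<gamma>_def Pi_iff)
  next
    fix s t x assume R: "(s, t, x) \<in> R"
    then have Q: "(s, t, x) \<in> Q" and s: "0 \<le> s" using RQ R_sub by auto
    have "fst (L s) = s" "fst (H s) = s"
      using L(2)[OF s] L(3)[OF s Q] H(2)[OF s] H(3)[OF s Q] by auto
    then have "L s = (s, t, x)" "H s = (s, t, x)"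
      using Q_uniq[OF L(1)[OF s] Q] Q_uniq[OF H(1)[OF s] Q] by auto
    then show "\<gamma>0 s = t \<and> \<gamma> s = x"
      using P_LH(1)[OF s] by (simp add: \<gamma>0_def \<gamma>_def)
  next
    fix r r' :: real assume r: "0 \<le> r" and rr: "r \<le> r'"
    then have r': "0 \<le> r'" by simp
    show "\<gamma>0 r \<le> \<gamma>0 r' \<and> \<gamma>0 r' - \<gamma>0 r + dist (\<gamma> r) (\<gamma> r') \<le> r' - r"
    \<comment> \<open>Either \<open>Q\<close> has a point with parameter in \<open>{r..r'}\<close>,
      and the estimate goes through \<open>H r\<close> and \<open>L r'\<close>, or both parameters
      lie in one gap, where time is constant and the path is 1-Lipschitz.\<close>
    proof (cases "fst (H r) \<le> r'")
      case True
      obtain b t x where Hr: "H r = (b, t, x)" by (metis prod.exhaust)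
      obtain a t' x' where Lr: "L r' = (a, t', x')" by (metis prod.exhaust)
      have Q: "(b, t, x) \<in> Q" "(a, t', x') \<in> Q" using H(1)[OF r] L(1)[OF r'] Hr Lr by auto
      have "b \<le> a" using L(3)[OF r' Q(1)] True Hr Lr by auto
      have 1: "dist (\<gamma> r) x \<le> b - r"
        using lipschitz_onD[OF P_LH(4)[OF r], of r b] P_LH(2)[OF r] L(2)[OF r] H(2)[OF r] Hr
        by (auto simp: \<gamma>_def dist_real_def)
      have 2: "dist x' (\<gamma> r') \<le> r' - a"
        using lipschitz_onD[OF P_LH(4)[OF r'], of a r'] P_LH(1)[OF r'] L(2)[OF r'] H(2)[OF r'] Lr
        by (auto simp: \<gamma>_def dist_real_def)
      have 3: "t \<le> t'" "t' - t + C * dist x x' \<le> a - b"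
        using Q_step[OF Q \<open>b \<le> a\<close>] by auto
      have "1 * dist x x' \<le> C * dist x x'" using C by (rule mult_right_mono) simp
      moreover have "dist (\<gamma> r) (\<gamma> r') \<le> dist (\<gamma> r) x + (dist x x' + dist x' (\<gamma> r'))"
        by (meson add_left_mono dist_triangle order_trans)
      moreover have "\<gamma>0 r = t" "\<gamma>0 r' = t'" using LH_time[OF r] Hr Lr by (auto simp: \<gamma>0_def)
      ultimately show ?thesis using 1 2 3 by auto
    next
      case False
      have "fst (L r') \<le> fst (L r)"
        using H(3)[OF r L(1)[OF r']] L(3)[OF r L(1)[OF r']] L(2)[OF r'] False by linarith
      moreover have "fst (L r) \<le> fst (L r')"
        using L(3)[OF r' L(1)[OF r]] L(2)[OF r] rr by linarith
      ultimately have L_eq: "L r' = L r"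
        by (intro Q_uniq L(1) r r') simp
      have "fst (H r') \<le> fst (H r)"
        using H(3)[OF r' H(1)[OF r]] False by linarith
      moreover have "fst (H r) \<le> fst (H r')"
        using H(3)[OF r H(1)[OF r']] H(2)[OF r'] rr by linarith
      ultimately have H_eq: "H r' = H r"
        by (intro Q_uniq H(1) r r') simp
      have "dist (\<gamma> r) (\<gamma> r') \<le> r' - r"
        using lipschitz_onD[OF P_LH(4)[OF r], of r r'] rr L(2)[OF r] False
        by (auto simp: \<gamma>_def L_eq H_eq dist_real_def)
      then show ?thesis by (simp add: \<gamma>0_def L_eq)
    qed
  qed
qed

section \<open>A graph with loops accumulating at the final time\<close>

lemma graph_with_loops:
  fixes U :: "'a::metric_space set"
  assumes T: "T > 0" and u: "u \<in> BV_loc T U" and y: "y \<in> U" and w: "w \<in> U" and C: "C \<ge> 0" and B: "B > 0"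
    and diam: "\<And>x x'. x \<in> U \<Longrightarrow> x' \<in> U \<Longrightarrow> C * dist x x' \<le> B"
  obtains R :: "(real \<times> real \<times> 'a) set" and a \<tau> b :: "nat \<Rightarrow> real" where
    "R \<subseteq> {0..} \<times> {0..T} \<times> U"
    "\<And>s t x s' t' x'. (s, t, x) \<in> R \<Longrightarrow> (s', t', x') \<in> R \<Longrightarrow> s \<le> s' \<Longrightarrow>
      t \<le> t' \<and> t' - t + C * dist x x' \<le> s' - s"
    "(0, 0, u 0) \<in> R" "\<And>t. 0 \<le> t \<Longrightarrow> t < T \<Longrightarrow> \<exists>s. (s, t, u t) \<in> R"
    "\<And>j. (a j, \<tau> j, y) \<in> R" "\<And>j. (b j, \<tau> j, w) \<in> R"
    "\<And>j. a j \<le> b j" "\<And>j. b j \<le> a (Suc j)" "\<And>j. real j * B \<le> a j" "\<tau> \<longlonglongrightarrow> T"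
proof -
  \<comment> \<open>\<open>K t\<close> is the number of \<open>j\<close> with \<open>\<tau> j < t\<close>.  The clock \<open>W\<close> pauses for \<open>3 * B\<close> right after each \<open>\<tau> j\<close>,
    long enough for an excursion from \<open>u (\<tau> j)\<close> to \<open>y\<close> and \<open>w\<close>.\<close>
  define K where "K t = real_of_int \<lceil>t / (T - t)\<rceil>" for t
  \<comment> \<open>\<open>\<tau> j\<close> solves \<open>t / (T - t) = real j\<close>, where the
    ceiling in \<open>K\<close> is about to jump.\<close>
  define \<tau> where "\<tau> j = T * real j / real (Suc j)" for j
  define W where "W t = t + C * variation_from u 0 t + 3 * B * K t" for t
  have \<tau>: "0 \<le> \<tau> j" "\<tau> j < T" "\<tau> j / (T - \<tau> j) = real j" for j
  proof -
    have "T - \<tau> j = T / real (Suc j)" by (simp add: \<tau>_def field_simps)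
    then show "\<tau> j / (T - \<tau> j) = real j" using T by (simp add: \<tau>_def)
  qed (use T in \<open>auto simp: \<tau>_def field_simps\<close>)
  have K_mono: "K t \<le> K t'" if "0 \<le> t" "t \<le> t'" "t' < T" for t t'
    using that unfolding K_def by (intro of_int_le_iff[THEN iffD2] ceiling_mono frac_le) auto
  have K_\<tau>: "K (\<tau> j) = real j" for j by (simp add: K_def \<tau>(3))
  have K_less: "K (\<tau> j) + 1 \<le> K t" if "\<tau> j < t" "t < T" for j t
  proof -
    have "real j = \<tau> j / (T - \<tau> j)" by (simp add: \<tau>)
    also have "\<dots> < t / (T - t)" using \<tau>(1)[of j] that by (intro frac_less) auto
    finally have "int j < \<lceil>t / (T - t)\<rceil>" by (simp add: less_ceiling_iff)
    then have "real j + 1 \<le> real_of_int \<lceil>t / (T - t)\<rceil>" by linarith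
    then show ?thesis unfolding K_\<tau> by (simp only: K_def)
  qed
  have W_step: "t' - t + C * dist (u t) (u t') + 3 * B * (K t' - K t) \<le> W t' - W t"
    if "0 \<le> t" "t \<le> t'" "t' < T" for t t'
  proof -
    have "total_variation u 0 t' < \<infinity>" using u that by (auto simp: BV_loc_def)
    from mult_left_mono[OF variation_from_step[OF that(1,2) this] C] show ?thesis
      by (simp add: W_def algebra_simps)
  qed
  have uU: "u t \<in> U" if "0 \<le> t" "t < T" for t using u that by (auto simp: BV_loc_def)
  \<comment> \<open>\<open>k\<close> is the delay in multiples of \<open>B\<close>: 0 on the graph,
    1 and 2 at the stops \<open>y\<close> and \<open>w\<close> of a loop. The third \<open>B\<close>
    of the pause is for the way back to the graph.\<close>
  define ok where "ok t k x \<longleftrightarrow> 0 \<le> t \<and> t < T \<and>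
    (k = 0 \<and> x = u t \<or> (\<exists>j. t = \<tau> j) \<and> (k = 1 \<and> x = y \<or> k = 2 \<and> x = w))" for t x and k :: nat
  define R where "R = {(W t + real k * B, t, x) | t k x. ok t k x}"
  have okU: "x \<in> U" if "ok t k x" for t k x
    using that uU y w by (auto simp: ok_def)
  have W0: "W 0 = 0" by (simp add: W_def K_def)
  have W_nonneg: "0 \<le> W t" if "0 \<le> t" "t < T" for t
  proof -
    have "0 \<le> C * dist (u 0) (u t)" "0 \<le> 3 * B * (K t - K 0)"
      using C B K_mono[of 0 t] that by auto
    with W_step[of 0 t] that show ?thesis by (simp add: W0)
  qed
  have later: "t' - t + C * dist x x' \<le> (W t' + real k' * B) - (W t + real k * B)"
    if ok: "ok t k x" "ok t' k' x'" and "t < t'" for t k x t' k' x'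
  proof -
    have t: "0 \<le> t" "t \<le> t'" "t' < T" "t < T" "0 \<le> t'" using that by (auto simp: ok_def)
    have d: "C * dist x x' \<le> B" using okU ok by (intro diam)
    have d0: "0 \<le> C * dist (u t) (u t')" using C by simp
    have k: "0 \<le> real k' * B" "k' = 0 \<or> B \<le> real k' * B" using B by auto
    show ?thesis
    \<comment> \<open>From a graph point to a stop, the distance is paid by the delay of that stop,
      at least \<open>B\<close>. From a stop, \<open>t\<close> is some \<open>\<tau> j\<close> and a
      pause of \<open>3 * B\<close> follows: it covers the delay of at most \<open>2 * B\<close> and
      a distance costing at most \<open>B\<close>.\<close>
    proof (cases "k = 0")
      case True
      have "0 \<le> 3 * B * (K t' - K t)" using B K_mono[OF t(1-3)] by simp
      moreover have "k' = 0 \<longrightarrow> x' = u t'" "x = u t" using ok True by (auto simp: ok_def)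
      ultimately show ?thesis using W_step[OF t(1-3)] d d0 k True by (cases "k' = 0") auto
    next
      case False
      then obtain j where "t = \<tau> j" and k2: "k \<le> 2" using ok by (auto simp: ok_def)
      then have "3 * B * 1 \<le> 3 * B * (K t' - K t)"
        using K_less[of j t'] \<open>t < t'\<close> t(3) B by (intro mult_left_mono) auto
      moreover have "real k * B \<le> 2 * B" using k2 B by (intro mult_right_mono) auto
      ultimately show ?thesis using W_step[OF t(1-3)] d d0 k by linarith
    qed
  qed
  show thesis
  proof (rule that[of R "\<lambda>j. W (\<tau> j) + B" \<tau> "\<lambda>j. W (\<tau> j) + 2 * B"])
    show "R \<subseteq> {0..} \<times> {0..T} \<times> U"
      using okU W_nonneg B by (auto simp: R_def) (auto simp: ok_def)
  next
    fix s t x s' t' x' assume R: "(s, t, x) \<in> R" "(s', t', x') \<in> R" and ss: "s \<le> s'"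
    obtain k k' where k: "s = W t + real k * B" "ok t k x" "s' = W t' + real k' * B" "ok t' k' x'"
      using R by (auto simp: R_def)
    consider "t < t'" | "t = t'" | "t' < t" by linarith
    then show "t \<le> t' \<and> t' - t + C * dist x x' \<le> s' - s"
    proof cases
      case 1
      then show ?thesis using later[OF k(2,4)] k by simp
    next
      case 2
      show ?thesis
      proof (cases "k = k'")
        case True
        then have "x = x'" using k(2,4) 2 by (auto simp: ok_def)
        then show ?thesis using 2 ss by simp
      next
        case False
        \<comment> \<open>At one time, distinct delays differ by at least \<open>B\<close>, which
          dominates \<open>C\<close> times any distance in \<open>U\<close>.\<close>
        have "real k * B \<le> real k' * B" using k ss 2 by simp
        then have "k + 1 \<le> k'" using False B by simp
        then have "(real k + 1) * B \<le> real k' * B" using B by (intro mult_right_mono) auto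
        then show ?thesis using diam[OF okU[OF k(2)] okU[OF k(4)]] 2 k by (simp add: algebra_simps)
      qed
    next
      case 3
      moreover have "0 \<le> C * dist x' x" using C by simp
      ultimately show ?thesis using later[OF k(4,2)] k ss by linarith
    qed
  next
    have "ok 0 0 (u 0)" using T by (simp add: ok_def)
    then show "(0, 0, u 0) \<in> R" unfolding R_def using W0 by force
  next
    fix t assume "0 \<le> t" "t < T"
    then have "ok t 0 (u t)" by (simp add: ok_def)
    then show "\<exists>s. (s, t, u t) \<in> R" unfolding R_def by blast
  next
    fix j
    have "ok (\<tau> j) 1 y" "ok (\<tau> j) 2 w" using \<tau> by (auto simp: ok_def)
    then show "(W (\<tau> j) + B, \<tau> j, y) \<in> R" "(W (\<tau> j) + 2 * B, \<tau> j, w) \<in> R"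
      unfolding R_def by force+
    show "W (\<tau> j) + B \<le> W (\<tau> j) + 2 * B" using B by simp
    have \<tau>_Suc: "\<tau> j < \<tau> (Suc j)" using T by (simp add: \<tau>_def field_simps)
    have "0 \<le> C * dist (u (\<tau> j)) (u (\<tau> (Suc j)))" using C by simp
    with W_step[of "\<tau> j" "\<tau> (Suc j)"] \<tau>[of j] \<tau>[of "Suc j"] \<tau>_Suc B
    show "W (\<tau> j) + 2 * B \<le> W (\<tau> (Suc j)) + B" by (simp add: K_\<tau>)
    have "0 \<le> C * dist (u 0) (u (\<tau> j))" "0 \<le> real j * B" using C B by auto
    moreover have "\<tau> j + C * dist (u 0) (u (\<tau> j)) + 3 * (real j * B) \<le> W (\<tau> j)"
      using W_step[of 0 "\<tau> j"] \<tau>[of j] by (simp add: K_\<tau> W0 K_def[of 0] mult_ac)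
    ultimately show "real j * B \<le> W (\<tau> j) + B" using \<tau>(1)[of j] B by linarith
  next
    have "(\<lambda>j. T * (real j / real (Suc j))) \<longlonglongrightarrow> T * 1"
      by (intro tendsto_intros LIMSEQ_n_over_Suc_n)
    then show "\<tau> \<longlonglongrightarrow> T" by (simp add: \<tau>_def[abs_def])
  qed
qed

section \<open>An infinitely long curve through the graph\<close>

lemma arclength_loop_curve:
  fixes U :: "'a::real_normed_vector set"
  assumes T: "T > 0" and U: "compact U" and whitney: "whitney_property U"
    and u: "u \<in> BV_loc T U" and w: "w \<in> U" "w \<noteq> u T"
  obtains \<phi>0 \<phi> r where
    "\<And>r r'. r \<le> r' \<Longrightarrow> \<phi>0 r \<le> \<phi>0 r' \<and> \<phi>0 r' - \<phi>0 r + dist (\<phi> r) (\<phi> r') \<le> r' - r"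
    "\<And>r. 0 \<le> r \<Longrightarrow> ereal (r - (\<phi>0 r - \<phi>0 0)) \<le> total_variation \<phi> 0 r"
    "\<And>r. \<phi>0 r \<in> {0..T} \<and> \<phi> r \<in> U" "\<phi>0 0 = 0" "\<phi> 0 = u 0"
    "\<And>t. 0 \<le> t \<Longrightarrow> t < T \<Longrightarrow> \<exists>r\<ge>0. \<phi>0 r = t \<and> \<phi> r = u t"
    "\<And>j::nat. 0 \<le> r j" "incseq r" "filterlim r at_top sequentially"
    "\<And>j. \<phi> (r j) = u T" "(\<lambda>j. \<phi>0 (r j)) \<longlonglongrightarrow> T"
proof -
  obtain C where C: "C \<ge> 1" and path: "\<And>x y a b. \<lbrakk>x \<in> U; y \<in> U; C * dist x y \<le> b - a\<rbrakk> \<Longrightarrow>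
      \<exists>p. p a = x \<and> p b = y \<and> p \<in> {a..b} \<rightarrow> U \<and> 1-lipschitz_on {a..b} p"
    using whitney_property_lipschitz_paths[OF whitney] by blast
  have C0: "0 \<le> C" using C by simp
  have uT: "u T \<in> U" using u T by (auto simp: BV_loc_def)
  \<comment> \<open>\<open>B\<close> dominates \<open>C\<close> times every distance in
    \<open>U\<close>; the added 1 makes it positive at once.\<close>
  define B where "B = C * diameter U + 1"
  have B: "B > 0" using diameter_ge_0[OF compact_imp_bounded[OF U]] C by (simp add: B_def add_nonneg_pos)
  have diam: "C * dist x x' \<le> B" if "x \<in> U" "x' \<in> U" for x x'
  proof -
    have "C * dist x x' \<le> C * diameter U"
      using C that by (intro mult_left_mono diameter_bounded_bound compact_imp_bounded U) auto
    then show ?thesis by (simp add: B_def)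
  qed
  obtain R a \<tau> b where R_sub: "R \<subseteq> {0..} \<times> {0..T} \<times> U"
    and R_step: "\<And>s t x s' t' x'. (s, t, x) \<in> R \<Longrightarrow> (s', t', x') \<in> R \<Longrightarrow> s \<le> s' \<Longrightarrow>
      t \<le> t' \<and> t' - t + C * dist x x' \<le> s' - s"
    and R_start: "(0, 0, u 0) \<in> R" and R_graph: "\<And>t. 0 \<le> t \<Longrightarrow> t < T \<Longrightarrow> \<exists>s. (s, t, u t) \<in> R"
    and a: "\<And>j. (a j, \<tau> j, u T) \<in> R" and b: "\<And>j. (b j, \<tau> j, w) \<in> R"
    and ab: "\<And>j::nat. a j \<le> b j" "\<And>j. b j \<le> a (Suc j)" "\<And>j. real j * B \<le> a j" and \<tau>: "\<tau> \<longlonglongrightarrow> T"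
    by (rule graph_with_loops[OF T u uT w(1) C0 B diam], assumption, assumption, rule that, assumption+)
  have a_pos: "0 \<le> a j" for j
    using ab(3)[of j] B by (meson mult_nonneg_nonneg of_nat_0_le_iff less_imp_le order_trans)
  obtain \<gamma>0 \<gamma> where
    step: "\<And>r r'. 0 \<le> r \<Longrightarrow> r \<le> r' \<Longrightarrow> \<gamma>0 r \<le> \<gamma>0 r' \<and> \<gamma>0 r' - \<gamma>0 r + dist (\<gamma> r) (\<gamma> r') \<le> r' - r"
    and range: "\<And>r. 0 \<le> r \<Longrightarrow> \<gamma>0 r \<in> {0..T} \<and> \<gamma> r \<in> U"
    and through: "\<And>s t x. (s, t, x) \<in> R \<Longrightarrow> \<gamma>0 s = t \<and> \<gamma> s = x"
  proof (rule lipschitz_curve_through[OF U C path R_sub R_step R_start])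
    show "\<exists>s x. (s, t, x) \<in> R" if "0 \<le> t" "t < T" for t using R_graph[OF that] by blast
    show "\<exists>s t x. (s, t, x) \<in> R \<and> r \<le> s" for r
    proof -
      obtain j :: nat where "r < real j * B" using reals_Archimedean3[OF B] by blast
      then show ?thesis using a[of j] ab(3)[of j] by (meson less_imp_le order_trans)
    qed
  qed auto
  define l where "l s = \<gamma>0 s + variation_from \<gamma> 0 s" for s
  have l_step: "\<gamma>0 s' - \<gamma>0 s + dist (\<gamma> s) (\<gamma> s') \<le> l s' - l s" if "0 \<le> s" "s \<le> s'" for s s'
    unfolding l_def by (rule arclength_step(1)[OF _ that], rule step)
  have l_mono: "l s \<le> l s'" if "0 \<le> s" "s \<le> s'" for s s'
    using l_step[OF that] step[OF that] zero_le_dist[of "\<gamma> s" "\<gamma> s'"] by linarith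
  have l0: "l 0 = 0" using through[OF R_start] by (simp add: l_def)
  \<comment> \<open>Each loop moves from \<open>u T\<close> to \<open>w\<close>, so the arc length
    at the visits \<open>a j\<close> to \<open>u T\<close> grows at least linearly. This gives both
    the infinite length and the sequence along which \<open>\<phi>\<close> equals
    \<open>u T\<close>.\<close>
  have l_a: "real j * dist w (u T) \<le> l (a j)" for j
  proof (induction j)
    case 0
    show ?case using l_mono[of 0 "a 0"] a_pos[of 0] l0 by simp
  next
    case (Suc j)
    have "dist w (u T) \<le> l (b j) - l (a j)"
      using l_step[OF a_pos ab(1), of j] through[OF a[of j]] through[OF b[of j]] by (simp add: dist_commute)
    moreover have "l (b j) \<le> l (a (Suc j))"
      using a_pos[of j] ab(1)[of j] ab(2)[of j] by (intro l_mono) auto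
    ultimately show ?case using Suc by (simp add: algebra_simps)
  qed
  have dist_pos: "0 < dist w (u T)" using w by simp
  obtain \<phi>0 \<phi> where \<phi>:
    "\<And>r r'. r \<le> r' \<Longrightarrow> \<phi>0 r \<le> \<phi>0 r' \<and> \<phi>0 r' - \<phi>0 r + dist (\<phi> r) (\<phi> r') \<le> r' - r"
    "\<And>r. 0 \<le> r \<Longrightarrow> ereal (r - (\<phi>0 r - \<phi>0 0)) \<le> total_variation \<phi> 0 r"
    "\<And>s. 0 \<le> s \<Longrightarrow> \<phi>0 (l s) = \<gamma>0 s \<and> \<phi> (l s) = \<gamma> s"
    "\<And>r. \<exists>s\<ge>0. \<phi>0 r = \<gamma>0 s \<and> \<phi> r = \<gamma> s"
  proof (rule arclength_reparametrization[of \<gamma>0 \<gamma>, OF step])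
    show "\<gamma>0 0 = 0" using through[OF R_start] by simp
    fix r
    obtain j :: nat where "r < real j * dist w (u T)" using reals_Archimedean3[OF dist_pos] by blast
    then show "\<exists>s\<ge>0. r \<le> \<gamma>0 s + variation_from \<gamma> 0 s"
      using l_a[of j] a_pos[of j] unfolding l_def by (intro exI[of _ "a j"]) auto
  qed (auto simp: l_def)
  show thesis
  proof (rule that[of \<phi>0 \<phi> "\<lambda>j. l (a j)", OF \<phi>(1,2)])
    show "\<phi>0 r \<in> {0..T} \<and> \<phi> r \<in> U" for r using \<phi>(4)[of r] range by metis
    show "\<phi>0 0 = 0" "\<phi> 0 = u 0" using \<phi>(3)[of 0] through[OF R_start] l0 by auto
    show "\<exists>r\<ge>0. \<phi>0 r = t \<and> \<phi> r = u t" if "0 \<le> t" "t < T" for t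
    proof -
      from R_graph[OF that] obtain s where s: "(s, t, u t) \<in> R" by blast
      then have "0 \<le> s" using R_sub by auto
      then show ?thesis using \<phi>(3)[of s] through[OF s] l_mono[of 0 s] l0 by (intro exI[of _ "l s"]) auto
    qed
    show "0 \<le> l (a j)" for j using l_mono[of 0 "a j"] a_pos[of j] l0 by simp
    show "incseq (\<lambda>j. l (a j))"
      using ab(1,2) by (intro incseq_SucI l_mono a_pos) (metis order_trans)
    have "filterlim (\<lambda>j. real j * dist w (u T)) at_top sequentially"
      using dist_pos by (intro filterlim_at_top_mult_tendsto_pos[OF tendsto_const _ filterlim_real_sequentially])
    then show "filterlim (\<lambda>j. l (a j)) at_top sequentially"
      by (rule filterlim_at_top_mono) (simp add: l_a)
    show "\<phi> (l (a j)) = u T" for j using \<phi>(3)[OF a_pos[of j]] through[OF a[of j]] by simp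
    have "\<phi>0 (l (a j)) = \<tau> j" for j using \<phi>(3)[OF a_pos[of j]] through[OF a[of j]] by simp
    then show "(\<lambda>j. \<phi>0 (l (a j))) \<longlonglongrightarrow> T" using \<tau> by simp
  qed
qed

section \<open>Graph completions\<close>

lemma Ico0_infinity: "Ico0 \<infinity> = {0..}"
  by (auto simp: Ico0_def)

text \<open>Infinite length needs a second point in \<open>U\<close>: for \<open>U = {u 0}\<close>,
  \<open>\<phi>\<close> is constant, \<open>\<phi>0' = 1\<close> almost everywhere, and
  \<open>\<phi>0\<close> reaches \<open>T\<close> at the finite parameter \<open>T\<close>.\<close>

lemma infinite_graph_completion:
  fixes U :: "'a::euclidean_space set" and V :: "'b::euclidean_space set"
  assumes T: "T > 0" and U: "compact U" "whitney_property U" "U \<noteq> {u 0}"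
    and u: "u \<in> BV_loc T U" and v: "v \<in> L1 T V"
  obtains \<phi>0 \<phi> \<psi> where "BV_loc_graph_completion U V T (u 0) u v \<phi>0 \<phi> \<psi> \<infinity>"
proof -
  have u0: "u 0 \<in> U" using u T by (auto simp: BV_loc_def)
  then obtain w where w: "w \<in> U" "w \<noteq> u T" using U(3) by (metis insertI1 subsetI subset_singletonD singletonD empty_iff)
  obtain \<phi>0 \<phi> r where
    step: "\<And>r r'. r \<le> r' \<Longrightarrow> \<phi>0 r \<le> \<phi>0 r' \<and> \<phi>0 r' - \<phi>0 r + dist (\<phi> r) (\<phi> r') \<le> r' - r"
    and tight: "\<And>r. 0 \<le> r \<Longrightarrow> ereal (r - (\<phi>0 r - \<phi>0 0)) \<le> total_variation \<phi> 0 r"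
    and range: "\<And>r. \<phi>0 r \<in> {0..T} \<and> \<phi> r \<in> U" and start: "\<phi>0 0 = 0" "\<phi> 0 = u 0"
    and graph: "\<And>t. 0 \<le> t \<Longrightarrow> t < T \<Longrightarrow> \<exists>r\<ge>0. \<phi>0 r = t \<and> \<phi> r = u t"
    and r: "\<And>j::nat. 0 \<le> r j" "incseq r" "filterlim r at_top sequentially"
    "\<And>j. \<phi> (r j) = u T" "(\<lambda>j. \<phi>0 (r j)) \<longlonglongrightarrow> T"
    by (rule arclength_loop_curve[OF T U(1,2) u w]) blast
  define \<psi> where "\<psi> s = v (\<phi>0 s)" for s
  have lip: "1-lipschitz_on UNIV (\<lambda>s. (\<phi>0 s, \<phi> s))"
    using step by (rule lipschitz_on_Pair_increment)
  have "continuous_on UNIV (\<lambda>s. fst (\<phi>0 s, \<phi> s))"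
    by (intro continuous_on_fst lipschitz_on_continuous_on[OF lip])
  then have [measurable]: "\<phi>0 \<in> borel_measurable borel"
    by (intro borel_measurable_continuous_onI) simp
  \<comment> \<open>\<open>\<phi>0\<close> stands still across gaps and can pull null sets back to
    sets of positive measure, so the composition rests on Borel measurability of \<open>v\<close>,
    which \<open>L1\<close> supplies through \<open>lborel\<close>. The extension by 0 is harmless,
    as \<open>\<phi>0\<close> stays in \<open>{0..T}\<close>.\<close>
  have [measurable]: "(\<lambda>t. indicat_real {0..T} t *\<^sub>R v t) \<in> borel_measurable borel"
    using v borel_measurable_integrable[of lborel] by (auto simp: L1_def set_integrable_def)
  have "\<psi> = (\<lambda>s. indicat_real {0..T} (\<phi>0 s) *\<^sub>R v (\<phi>0 s))"
    using range by (auto simp: \<psi>_def indicator_def)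
  also have "\<dots> \<in> borel_measurable borel"
    by (rule measurable_compose[of \<phi>0 borel borel "\<lambda>t. indicat_real {0..T} t *\<^sub>R v t"]) measurable
  finally have \<psi>_meas: "\<psi> \<in> borel_measurable (lebesgue_on A)" for A
    by (intro measurable_restrict_space1 measurable_completion) simp
  \<comment> \<open>\<open>\<phi>0\<close> is monotone and bounded by \<open>T\<close>, so
    convergence along the sequence \<open>r\<close> suffices.\<close>
  have "(\<phi>0 \<longlongrightarrow> T) at_top"
  proof (rule increasing_tendsto)
    show "\<forall>\<^sub>F s in at_top. \<phi>0 s \<le> T" using range by auto
    fix x assume "x < T"
    then obtain j where "x < \<phi>0 (r j)"
      using order_tendstoD(1)[OF r(5)] by (meson eventually_happens' sequentially_bot)
    then show "\<forall>\<^sub>F s in at_top. x < \<phi>0 s"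
      unfolding eventually_at_top_linorder using step by (metis less_le_trans)
  qed
  moreover have "u T \<in> limit_set \<phi>"
    unfolding limit_set_def using r by (auto intro!: exI[of _ r])
  moreover have "\<forall>t\<in>{0..<T}. \<exists>s\<in>{0..}. \<phi>0 s = t \<and> \<phi> s = u t \<and> \<psi> s = v t"
    using graph by (fastforce simp: \<psi>_def)
  moreover have "\<psi> s \<in> V" for s
    using v range by (auto simp: \<psi>_def L1_def Pi_iff)
  moreover have "(\<phi>0, \<phi>, \<psi>, \<infinity>) \<in> space_time_controls U V T (u 0)" if "(\<phi>0 \<longlongrightarrow> T) at_top" "\<And>s. \<psi> s \<in> V"
    unfolding space_time_controls_def Ico0_infinity towards_def mem_Collect_eq prod.case
    using that range start \<psi>_meas lipschitz_on_subset[OF lip, of "{0..}"]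
    by (intro conjI arclength_parametrization_ae[OF step tight]) auto
  ultimately have "BV_loc_graph_completion U V T (u 0) u v \<phi>0 \<phi> \<psi> \<infinity>"
    by (simp add: BV_loc_graph_completion_def curve_value_def towards_def Ico0_infinity)
  then show thesis by (rule that)
qed

lemma infinite_graph_completion_solution:
  fixes g0 :: "real^'n \<Rightarrow> real^'m \<Rightarrow> real^'l \<Rightarrow> real^'n"
    and g :: "'m \<Rightarrow> real^'n \<Rightarrow> real^'m \<Rightarrow> real^'n"
  assumes compl: "BV_loc_graph_completion U V T u0 u v \<phi>0 \<phi> \<psi> \<infinity>"
    and clock: "clock T u \<phi>0 \<phi> \<infinity> \<sigma>"
    and sol: "space_time_solution g0 g x0 \<phi>0 \<phi> \<psi> \<infinity> \<xi>"
    and bdd: "bounded (\<xi> ` {0..})"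
  obtains x where "BV_loc_graph_completion_solution g0 g U V T x0 u0 u v \<phi>0 \<phi> \<psi> \<infinity> \<sigma> \<xi> x"
proof -
  have "u T \<in> limit_set \<phi>" using compl by (simp add: BV_loc_graph_completion_def curve_value_def)
  then obtain s :: "nat \<Rightarrow> real" where s: "\<And>j. 0 \<le> s j" "incseq s" "filterlim s at_top sequentially"
    "(\<lambda>j. \<phi> (s j)) \<longlonglongrightarrow> u T"
    by (auto simp: limit_set_def)
  \<comment> \<open>\<open>\<phi>\<close> already tends to \<open>u T\<close> along
    \<open>s\<close>, and a subsequence chosen for \<open>\<xi>\<close> keeps that limit; the
    terminal condition asks for both limits along one sequence.\<close>
  have "bounded (range (\<lambda>j. \<xi> (s j)))"
    by (rule bounded_subset[OF bdd]) (use s(1) in auto)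
  then obtain l k where k: "strict_mono k" "((\<lambda>j. \<xi> (s j)) \<circ> k) \<longlonglongrightarrow> l"
    using bounded_imp_convergent_subsequence by blast
  have "(l, u T) \<in> limit_set (\<lambda>s. (\<xi> s, \<phi> s))"
    unfolding limit_set_def mem_Collect_eq
  proof (intro exI conjI)
    show "\<forall>j. 0 \<le> (s \<circ> k) j" using s(1) by simp
    show "incseq (s \<circ> k)" using s(2) k(1) by (simp add: incseq_def strict_mono_less_eq)
    show "filterlim (s \<circ> k) at_top sequentially"
      unfolding comp_def by (rule filterlim_compose[OF s(3) filterlim_subseq[OF k(1)]])
    show "(\<lambda>j. (\<xi> ((s \<circ> k) j), \<phi> ((s \<circ> k) j))) \<longlonglongrightarrow> (l, u T)"
      using k(2) LIMSEQ_subseq_LIMSEQ[OF s(4) k(1)] by (intro tendsto_Pair) (auto simp: comp_def)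
  qed
  then have "BV_loc_graph_completion_solution g0 g U V T x0 u0 u v \<phi>0 \<phi> \<psi> \<infinity> \<sigma> \<xi>
      (\<lambda>t. if t < T then \<xi> (real_of_ereal (\<sigma> t)) else l)"
    using compl clock sol bdd by (simp add: BV_loc_graph_completion_solution_def Ico0_infinity)
  then show thesis by (rule that)
qed

theorem theorem2p1:
  fixes g0 :: "real^'n \<Rightarrow> real^'m \<Rightarrow> real^'l \<Rightarrow> real^'n"
    and g :: "'m \<Rightarrow> real^'n \<Rightarrow> real^'m \<Rightarrow> real^'n"
    and U :: "(real^'m) set" and V :: "(real^'l) set"
    and T M :: real and x0 :: "real^'n" and u0 :: "real^'m"
    and u :: "real \<Rightarrow> real^'m" and v :: "real \<Rightarrow> real^'l"
  assumes "T > 0" and "compact U" and "compact V" and "u0 \<in> U"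
    and "continuous_on (UNIV \<times> U \<times> V) (\<lambda>(x, w, z). g0 x w z)"
    and "locally_lipschitz_on_unif (UNIV \<times> U) V (\<lambda>z (x, w). g0 x w z)"
    and "\<And>i. locally_lipschitz_on (UNIV \<times> U) (\<lambda>(x, w). g i x w)"
    and "M > 0"
    and "\<And>x w z. w \<in> U \<Longrightarrow> z \<in> V \<Longrightarrow>
           norm (g0 x w z, \<chi> i. g i x w) \<le> M * (1 + norm (x, w))"
    and "whitney_property U"
    and "U \<noteq> {u0}"
    and "u \<in> BV_loc T U" and "v \<in> L1 T V" and "u 0 = u0"
  shows "\<exists>\<phi>0 \<phi> \<psi>.
      BV_loc_graph_completion U V T u0 u v \<phi>0 \<phi> \<psi> \<infinity> \<and>
      (\<forall>\<sigma> \<xi>. clock T u \<phi>0 \<phi> \<infinity> \<sigma> \<and>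
             space_time_solution g0 g x0 \<phi>0 \<phi> \<psi> \<infinity> \<xi> \<and>
             bounded (\<xi> ` {0..}) \<longrightarrow>
         (\<exists>x. BV_loc_graph_completion_solution g0 g U V T x0 u0 u v \<phi>0 \<phi> \<psi> \<infinity> \<sigma> \<xi> x))"
proof -
  note T = assms(1) and U = assms(2,10,11) and uv = assms(12,13) and u0 = assms(14)
  obtain \<phi>0 \<phi> \<psi> where compl: "BV_loc_graph_completion U V T u0 u v \<phi>0 \<phi> \<psi> \<infinity>"
    using infinite_graph_completion[OF T U(1,2) _ uv] U(3) u0 by metis
  then show ?thesis
    by (metis infinite_graph_completion_solution)
qed

end
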